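(* For $n\ge1$ let $c^n_{x,y}$ be the conductances of the set consisting of the bottom row $x_0,\dots,x_{2^n}$ of $V_n$ together with the top point $q_0$, and set $l_n=c^n_{x_0,x_1}$. Then $l_1=\frac{20}{9}$ and, for $n\ge1$, $$l_{n+1}=\frac53\,l_n+\frac{98\cdot25^{n+1}(10\cdot3^{n+1}+39\cdot10^{n+1})}{(3^{n+1}+6\cdot10^{n+1})(5\cdot3^{n+1}+16\cdot10^{n+1})(5\cdot3^{n+1}+9\cdot10^{n+1})}.$$
   Context: Let $q_0,q_1,q_2$ be the vertices of an equilateral triangle in the plane, $F_i(x)=\frac12(x+q_i)$, and let $SG$ (the Sierpinski gasket) be the unique nonempty compact set with $SG=\bigcup_{i}F_i(SG)$. For a word $w$ of length $m$ let $F_w=F_{w_1}\circ\cdots\circ F_{w_m}$. Put $V_0=\{q_0,q_1,q_2\}$, $V_m=\bigcup_iF_iV_{m-1}$; $x\sim_m y$ means $x\ne y$ and $x,y\in F_wV_0$ for some word $w$ of length $m$. The bottom row of $V_n$ consists of the points $x_i=q_1+\frac{i}{2^n}(q_2-q_1)$, $0\le i\le2^n$. The energy of a continuous $u:SG\to\mathbb{R}$ is $\mathcal{E}(u)=\lim_{m\to\infty}\left(\frac53\right)^m\sum_{\{x,y\}:x\sim_m y}(u(x)-u(y))^2$ (a nondecreasing limit), and $\operatorname{dom}\mathcal{E}$ is the set of continuous $u$ with $\mathcal{E}(u)<\infty$. For a nonempty set $A\subset V_n$ and values prescribed on $A$, there is a unique $u\in\operatorname{dom}\mathcal{E}$ of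 least energy with these values on $A$, and its energy has the form $\mathcal{E}(u)=\sum_{\{x,y\}\subset A}c_{x,y}(u(x)-u(y))^2$; the (uniquely determined, symmetric) coefficients $c_{x,y}$, $x\neq y$, are the conductances of $A$. *)

theory Defs
  imports "HOL-Analysis.Analysis"
begin

text \<open>
  Throughout, the vertices of the triangle are \<open>q 0\<close>, \<open>q 1\<close>, \<open>q 2\<close> for a function \<open>q\<close> on the
  natural numbers; the values of \<open>q\<close> at other indices are never used.
\<close>

definition equilateral :: "(nat \<Rightarrow> real ^ 2) \<Rightarrow> bool" where
  "equilateral q \<longleftrightarrow>
     q 0 \<noteq> q 1 \<and> dist (q 0) (q 1) = dist (q 1) (q 2) \<and> dist (q 1) (q 2) = dist (q 2) (q 0)"

definition F :: "(nat \<Rightarrow> real ^ 2) \<Rightarrow> nat \<Rightarrow> real ^ 2 \<Rightarrow> real ^ 2" where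
  "F q i x = (1/2) *\<^sub>R (x + q i)"

definition SG :: "(nat \<Rightarrow> real ^ 2) \<Rightarrow> (real ^ 2) set" where
  "SG q = (THE K. K \<noteq> {} \<and> compact K \<and> K = (\<Union>i\<in>{0,1,2}. F q i ` K))"

primrec F_word :: "(nat \<Rightarrow> real ^ 2) \<Rightarrow> nat list \<Rightarrow> real ^ 2 \<Rightarrow> real ^ 2" where
  "F_word q [] = id"
| "F_word q (i # w) = F q i \<circ> F_word q w"

primrec V :: "(nat \<Rightarrow> real ^ 2) \<Rightarrow> nat \<Rightarrow> (real ^ 2) set" where
  "V q 0 = {q 0, q 1, q 2}"
| "V q (Suc m) = (\<Union>i\<in>{0,1,2}. F q i ` V q m)"

definition nbr :: "(nat \<Rightarrow> real ^ 2) \<Rightarrow> nat \<Rightarrow> real ^ 2 \<Rightarrow> real ^ 2 \<Rightarrow> bool" where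
  "nbr q m x y \<longleftrightarrow> x \<noteq> y \<and>
     (\<exists>w. length w = m \<and> set w \<subseteq> {0,1,2} \<and> x \<in> F_word q w ` V q 0 \<and> y \<in> F_word q w ` V q 0)"

text \<open>
  Sums over unordered pairs are written as one half of the corresponding sum over ordered pairs,
  here and in \<open>is_conductances\<close> below.
\<close>

definition graph_energy :: "(nat \<Rightarrow> real ^ 2) \<Rightarrow> nat \<Rightarrow> (real ^ 2 \<Rightarrow> real) \<Rightarrow> real" where
  "graph_energy q m u =
     (5/3) ^ m * ((\<Sum>(x, y) \<in> {(x, y). nbr q m x y}. (u x - u y)\<^sup>2) / 2)"

text \<open>
  Functions on the gasket are represented by functions on the whole plane, of which only the
  restriction to \<open>SG q\<close> matters. The limit is taken in the extended reals, where it may be \<open>\<infinity>\<close>.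
\<close>

definition energy :: "(nat \<Rightarrow> real ^ 2) \<Rightarrow> (real ^ 2 \<Rightarrow> real) \<Rightarrow> ereal" where
  "energy q u = lim (\<lambda>m. ereal (graph_energy q m u))"

definition dom_energy :: "(nat \<Rightarrow> real ^ 2) \<Rightarrow> (real ^ 2 \<Rightarrow> real) set" where
  "dom_energy q = {u. continuous_on (SG q) u \<and> energy q u < \<infinity>}"

definition least_energy_extension ::
    "(nat \<Rightarrow> real ^ 2) \<Rightarrow> (real ^ 2) set \<Rightarrow> (real ^ 2 \<Rightarrow> real) \<Rightarrow> (real ^ 2 \<Rightarrow> real) \<Rightarrow> bool" where
  "least_energy_extension q A h u \<longleftrightarrow>
     u \<in> dom_energy q \<and> (\<forall>x\<in>A. u x = h x) \<and>
     (\<forall>v\<in>dom_energy q. (\<forall>x\<in>A. v x = h x) \<longrightarrow> energy q u \<le> energy q v)"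

text \<open>
  Conductances are only meaningful for distinct points of \<open>A\<close>; all other values are set to \<open>0\<close>, so
  that the coefficients are uniquely determined as a function on the whole plane.
\<close>

definition is_conductances ::
    "(nat \<Rightarrow> real ^ 2) \<Rightarrow> (real ^ 2) set \<Rightarrow> (real ^ 2 \<Rightarrow> real ^ 2 \<Rightarrow> real) \<Rightarrow> bool" where
  "is_conductances q A c \<longleftrightarrow>
     (\<forall>x y. c x y = c y x) \<and>
     (\<forall>x y. x \<notin> A \<or> y \<notin> A \<or> x = y \<longrightarrow> c x y = 0) \<and>
     (\<forall>h. \<exists>u. least_energy_extension q A h u \<and>
        energy q u = ereal ((\<Sum>(x, y) \<in> A \<times> A. c x y * (u x - u y)\<^sup>2) / 2))"

definition conductance ::
    "(nat \<Rightarrow> real ^ 2) \<Rightarrow> (real ^ 2) set \<Rightarrow> real ^ 2 \<Rightarrow> real ^ 2 \<Rightarrow> real" where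
  "conductance q A = (THE c. is_conductances q A c)"

definition bottom_pt :: "(nat \<Rightarrow> real ^ 2) \<Rightarrow> nat \<Rightarrow> nat \<Rightarrow> real ^ 2" where
  "bottom_pt q n i = q 1 + (real i / 2 ^ n) *\<^sub>R (q 2 - q 1)"

definition bottom_row_and_top :: "(nat \<Rightarrow> real ^ 2) \<Rightarrow> nat \<Rightarrow> (real ^ 2) set" where
  "bottom_row_and_top q n = insert (q 0) (bottom_pt q n ` {0..2 ^ n})"

definition l :: "(nat \<Rightarrow> real ^ 2) \<Rightarrow> nat \<Rightarrow> real" where
  "l q n = conductance q (bottom_row_and_top q n) (bottom_pt q n 0) (bottom_pt q n 1)"

end

theory Submission
  imports Defs
begin

text \<open>
  Glue three copies of the gasket: the bottom row of level \<open>n + 1\<close> consists of two bottom rows of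
  level \<open>n\<close>, so the trace of the energy on this row and the top point arises from two traces of
  level \<open>n\<close> and a triangle by minimising over the values at the two inner vertices adjacent to the
  top. The top point interacts with the row only through the mean of the row values: the trace is
  \<open>P\<^sub>n(f) + S\<^sub>n (t - mean f)\<^sup>2\<close>, and minimising gives explicit recursions for \<open>S\<^sub>n\<close> and \<open>P\<^sub>n\<close>.
  Polarisation at the first two points of the row yields the recursion for \<open>l\<close>.

  Minimisers are glued from harmonic functions, which are uniform limits of functions obtained from
  affine ones by iterating the harmonic extension rule (weights \<open>2/5, 2/5, 1/5\<close>); the oscillation
  shrinks by \<open>3/5\<close> in each step.
\<close>

declare One_nat_def [simp del]

section \<open>Quadratic forms on a finite set\<close>

text \<open>The total weight \<open>w\<close> is recorded because weight 0 means that
  \<open>L\<close> annihilates constants, the condition under which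
  \<open>network_form_square\<close> applies.\<close>

definition weighted_sum :: "'a set \<Rightarrow> (('a \<Rightarrow> real) \<Rightarrow> real) \<Rightarrow> real \<Rightarrow> bool" where
  "weighted_sum A L w \<longleftrightarrow> (\<exists>a. sum a A = w \<and> (\<forall>h. L h = (\<Sum>x\<in>A. a x * h x)))"

text \<open>Ordered pairs and arbitrary real coefficients make closure under sums and multiples
  immediate; the normalised form comes from \<open>network_form_symmetric\<close>.\<close>

definition network_form :: "'a set \<Rightarrow> (('a \<Rightarrow> real) \<Rightarrow> real) \<Rightarrow> bool" where
  "network_form A Q \<longleftrightarrow> (\<exists>c. \<forall>h. Q h = (\<Sum>(x, y)\<in>A \<times> A. c x y * (h x - h y)\<^sup>2))"

lemma weighted_sum_eval:
  assumes "finite A" "x \<in> A"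
  shows "weighted_sum A (\<lambda>h. h x) 1"
  unfolding weighted_sum_def
proof (intro exI conjI allI)
  show "(\<Sum>y\<in>A. if y = x then 1 else 0) = (1::real)"
    using assms by simp
  show "h x = (\<Sum>y\<in>A. (if y = x then 1 else 0) * h y)" for h :: "'a \<Rightarrow> real"
    using assms by (simp add: if_distrib[of "\<lambda>t. t * _"] cong: if_cong)
qed

lemma weighted_sum_add:
  assumes "weighted_sum A L w" "weighted_sum A M v"
  shows "weighted_sum A (\<lambda>h. L h + M h) (w + v)"
proof -
  obtain a b where "sum a A = w" "\<And>h. L h = (\<Sum>x\<in>A. a x * h x)"
    "sum b A = v" "\<And>h. M h = (\<Sum>x\<in>A. b x * h x)"
    using assms unfolding weighted_sum_def by metis
  then show ?thesis
    unfolding weighted_sum_def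
    by (intro exI[of _ "\<lambda>x. a x + b x"]) (simp add: sum.distrib distrib_right)
qed

lemma weighted_sum_scale:
  assumes "weighted_sum A L w"
  shows "weighted_sum A (\<lambda>h. k * L h) (k * w)"
proof -
  obtain a where "sum a A = w" "\<And>h. L h = (\<Sum>x\<in>A. a x * h x)"
    using assms unfolding weighted_sum_def by metis
  then show ?thesis
    unfolding weighted_sum_def
    by (intro exI[of _ "\<lambda>x. k * a x"]) (auto simp: sum_distrib_left mult.assoc)
qed

lemma weighted_sum_diff:
  assumes "weighted_sum A L w" "weighted_sum A M v"
  shows "weighted_sum A (\<lambda>h. L h - M h) (w - v)"
  using weighted_sum_add[OF assms(1) weighted_sum_scale[OF assms(2), of "-1"]] by simp

text \<open>With coefficients \<open>- (a x * a y / 2)\<close>, expanding the squared differences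
  leaves only the cross terms: every pure square is multiplied by \<open>sum a A\<close>, which is
  0.\<close>

lemma network_form_square:
  assumes "weighted_sum A L 0"
  shows "network_form A (\<lambda>h. (L h)\<^sup>2)"
proof -
  obtain a where a: "sum a A = 0" and L: "\<And>h. L h = (\<Sum>x\<in>A. a x * h x)"
    using assms unfolding weighted_sum_def by metis
  have "(L h)\<^sup>2 = (\<Sum>(x, y)\<in>A \<times> A. - (a x * a y / 2) * (h x - h y)\<^sup>2)" for h
  proof -
    have "(\<Sum>(x, y)\<in>A \<times> A. - (a x * a y / 2) * (h x - h y)\<^sup>2) =
      (\<Sum>x\<in>A. \<Sum>y\<in>A. (a x * h x) * (a y * h y) - (a x * (h x)\<^sup>2) * (a y / 2)
         - (a x / 2) * (a y * (h y)\<^sup>2))"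
      unfolding sum.cartesian_product[symmetric]
      by (intro sum.cong refl) (simp add: power2_eq_square algebra_simps)
    also have "\<dots> = (L h)\<^sup>2"
      unfolding sum_subtractf sum_product[symmetric] sum_divide_distrib[symmetric] a L
      by (simp add: power2_eq_square)
    finally show ?thesis by simp
  qed
  then show ?thesis
    unfolding network_form_def by (intro exI[of _ "\<lambda>x y. - (a x * a y / 2)"]) blast
qed

lemma network_form_add:
  assumes "network_form A Q" "network_form A R"
  shows "network_form A (\<lambda>h. Q h + R h)"
proof -
  obtain c where c: "\<forall>h. Q h = (\<Sum>(x, y)\<in>A \<times> A. c x y * (h x - h y)\<^sup>2)"
    using assms(1) unfolding network_form_def ..
  obtain d where d: "\<forall>h. R h = (\<Sum>(x, y)\<in>A \<times> A. d x y * (h x - h y)\<^sup>2)"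
    using assms(2) unfolding network_form_def ..
  show ?thesis
    unfolding network_form_def
    by (intro exI[of _ "\<lambda>x y. c x y + d x y"])
      (simp add: c d sum.distrib case_prod_unfold distrib_right)
qed

lemma network_form_scale:
  assumes "network_form A Q"
  shows "network_form A (\<lambda>h. k * Q h)"
proof -
  obtain c where c: "\<forall>h. Q h = (\<Sum>(x, y)\<in>A \<times> A. c x y * (h x - h y)\<^sup>2)"
    using assms unfolding network_form_def ..
  show ?thesis
    unfolding network_form_def
    by (intro exI[of _ "\<lambda>x y. k * c x y"])
      (simp add: c sum_distrib_left case_prod_unfold mult.assoc)
qed

section \<open>Recovering and normalising the coefficients\<close>

text \<open>Polarisation: the combination of squared differences for the three indicators vanishes
  on every pair except (x, y) and (y, x), where it equals 2. This gives the uniqueness of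
  conductances.\<close>

lemma network_form_coefficient:
  fixes c :: "'a \<Rightarrow> 'a \<Rightarrow> real"
  assumes "finite A" "\<And>x y. c x y = c y x" "x \<in> A" "y \<in> A" "x \<noteq> y"
    and Q: "\<And>h. Q h = (\<Sum>(u, v)\<in>A \<times> A. c u v * (h u - h v)\<^sup>2) / 2"
  shows "c x y = (Q (indicator {x}) + Q (indicator {y}) - Q (indicator {x, y})) / 2"
proof -
  let ?f = "\<lambda>p u v. (indicator p u - indicator p v :: real)\<^sup>2"
  have "?f {x} u v + ?f {y} u v - ?f {x, y} u v =
      (if u = x then if v = y then 2 else 0 else 0) + (if u = y then if v = x then 2 else 0 else 0)"
    for u v
    using assms(5) by (auto simp: indicator_def)
  then have "c u v * ?f {x} u v + c u v * ?f {y} u v - c u v * ?f {x, y} u v =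
      (if u = x then if v = y then 2 * c u v else 0 else 0) +
      (if u = y then if v = x then 2 * c u v else 0 else 0)" for u v
    unfolding distrib_left[symmetric] right_diff_distrib[symmetric] by auto
  then have "(\<Sum>u\<in>A. \<Sum>v\<in>A. c u v * ?f {x} u v + c u v * ?f {y} u v - c u v * ?f {x, y} u v) =
      (\<Sum>u\<in>A. if u = x then \<Sum>v\<in>A. if v = y then 2 * c u v else 0 else 0) +
      (\<Sum>u\<in>A. if u = y then \<Sum>v\<in>A. if v = x then 2 * c u v else 0 else 0)"
    by (simp add: sum.distrib[symmetric]) (intro sum.cong refl, use assms(5) in \<open>auto intro!: sum.cong\<close>)
  also have "\<dots> = 4 * c x y"
    using assms(1-4) by simp
  finally show ?thesis
    unfolding Q by (simp add: sum.cartesian_product[symmetric] sum.distrib sum_subtractf)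
qed

text \<open>Adding the transposed coefficients doubles the sum, hence the division by 2; diagonal
  coefficients may be set to 0 because they multiply zero differences.\<close>

lemma network_form_symmetric:
  assumes "network_form A Q"
  obtains c where "\<And>x y. c x y = c y x" "\<And>x y. x \<notin> A \<or> y \<notin> A \<or> x = y \<Longrightarrow> c x y = 0"
    "\<And>h. Q h = (\<Sum>(x, y)\<in>A \<times> A. c x y * (h x - h y)\<^sup>2) / 2"
proof -
  obtain c where c: "\<And>h. Q h = (\<Sum>(x, y)\<in>A \<times> A. c x y * (h x - h y)\<^sup>2)"
    using assms unfolding network_form_def by blast
  let ?c = "\<lambda>x y. if x \<in> A \<and> y \<in> A \<and> x \<noteq> y then c x y + c y x else 0"
  have "(\<Sum>(x, y)\<in>A \<times> A. ?c x y * (h x - h y)\<^sup>2) = 2 * Q h" for h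
  proof -
    have "(\<Sum>(x, y)\<in>A \<times> A. ?c x y * (h x - h y)\<^sup>2) =
        (\<Sum>x\<in>A. \<Sum>y\<in>A. c x y * (h x - h y)\<^sup>2 + c y x * (h y - h x)\<^sup>2)"
      unfolding sum.cartesian_product[symmetric]
      by (intro sum.cong refl) (simp add: distrib_right power2_commute)
    also have "\<dots> = (\<Sum>x\<in>A. \<Sum>y\<in>A. c x y * (h x - h y)\<^sup>2) + (\<Sum>x\<in>A. \<Sum>y\<in>A. c y x * (h y - h x)\<^sup>2)"
      by (simp only: sum.distrib)
    also have "(\<Sum>x\<in>A. \<Sum>y\<in>A. c y x * (h y - h x)\<^sup>2) = (\<Sum>x\<in>A. \<Sum>y\<in>A. c x y * (h x - h y)\<^sup>2)"
      by (rule sum.swap)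
    finally show ?thesis
      by (simp add: c sum.cartesian_product)
  qed
  then show ?thesis
    by (intro that[of ?c]) (auto simp: add.commute)
qed

section \<open>The trace of the energy on the bottom row and the top point\<close>

text \<open>This is the trapezoidal mean: the middle point belongs to both halves, so inner points
  receive weight \<open>1 / 2 ^ n\<close> and the two end points half of that.\<close>

primrec row_mean :: "nat \<Rightarrow> (nat \<Rightarrow> real) \<Rightarrow> real" where
  "row_mean 0 f = (f 0 + f 1) / 2"
| "row_mean (Suc n) f = (row_mean n f + row_mean n (\<lambda>i. f (2 ^ n + i))) / 2"

text \<open>The total conductance between the top and the row. In each half a unit edge is in series
  with the conductance \<open>S\<close> of the lower copy, giving \<open>S / (1 + S)\<close>; two
  parallel halves and the energy factor 5/3 give the recursion.\<close>

primrec top_row_conductance :: "nat \<Rightarrow> real" where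
  "top_row_conductance 0 = 2"
| "top_row_conductance (Suc n) = 10 / 3 * top_row_conductance n / (1 + top_row_conductance n)"

text \<open>The part of the trace that remains when the top value equals the row mean. The last
  summand is the cost of unequal means on the two halves, after the difference of the inner vertex
  values has been optimised.\<close>

primrec row_form :: "nat \<Rightarrow> (nat \<Rightarrow> real) \<Rightarrow> real" where
  "row_form 0 f = 3 / 2 * (f 0 - f 1)\<^sup>2"
| "row_form (Suc n) f = 5 / 3 * (row_form n f + row_form n (\<lambda>i. f (2 ^ n + i)) +
     3 / 2 * (top_row_conductance n / (top_row_conductance n + 3)) *
       (row_mean n f - row_mean n (\<lambda>i. f (2 ^ n + i)))\<^sup>2)"

text \<open>The least energy for the value \<open>t\<close> at the top point and the values \<open>f i\<close> on the bottom row.\<close>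

definition trace_form :: "nat \<Rightarrow> real \<Rightarrow> (nat \<Rightarrow> real) \<Rightarrow> real" where
  "trace_form n t f = row_form n f + top_row_conductance n * (t - row_mean n f)\<^sup>2"

definition triangle_form :: "real \<Rightarrow> real \<Rightarrow> real \<Rightarrow> real" where
  "triangle_form a b c = (a - b)\<^sup>2 + (b - c)\<^sup>2 + (c - a)\<^sup>2"

lemma trace_form_0: "trace_form 0 t f = triangle_form t (f 0) (f 1)"
  by (simp add: trace_form_def triangle_form_def power2_eq_square field_simps)

lemma top_row_conductance_pos: "top_row_conductance n > 0"
  by (induction n) auto

lemma top_row_conductance_closed:
  "top_row_conductance n = 14 * 10 ^ n / (3 ^ n + 6 * 10 ^ n)"
proof (induction n)
  case (Suc n)
  have "(3::real) ^ n + 6 * 10 ^ n > 0" "(3::real) ^ n + 20 * 10 ^ n > 0"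
    by (simp_all add: add_pos_pos)
  then show ?case
    by (simp add: Suc divide_simps) (simp add: algebra_simps)
qed simp

text \<open>
  In the mean and the difference of \<open>a\<close> and \<open>b\<close> the two minimisations decouple.
\<close>

lemma eliminate_inner_vertices:
  fixes S :: real
  assumes "S > 0"
  shows "triangle_form t a b + S * (a - m)\<^sup>2 + S * (b - k)\<^sup>2 =
    2 * (S / (1 + S)) * (t - (m + k) / 2)\<^sup>2 + 3 / 2 * (S / (S + 3)) * (m - k)\<^sup>2 +
    2 * (1 + S) * ((a + b) / 2 - t - S * ((m + k) / 2 - t) / (1 + S))\<^sup>2 +
    (S + 3) / 2 * (a - b - S * (m - k) / (S + 3))\<^sup>2"
proof -
  define p r M N where "p = (a + b) / 2 - t" and "r = a - b" and "M = (m + k) / 2 - t"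
    and "N = m - k"
  have eqs: "a = t + p + r / 2" "b = t + p - r / 2" "m = t + M + N / 2" "k = t + M - N / 2"
    by (simp_all add: p_def r_def M_def N_def field_simps)
  have 1: "triangle_form t a b + S * (a - m)\<^sup>2 + S * (b - k)\<^sup>2 =
    (2 * p\<^sup>2 + 2 * S * (p - M)\<^sup>2) + (3 / 2 * r\<^sup>2 + S / 2 * (r - N)\<^sup>2)"
    unfolding eqs triangle_form_def by (simp add: power2_eq_square field_simps)
  have 2: "2 * p\<^sup>2 + 2 * S * (p - M)\<^sup>2 = 2 * (S / (1 + S)) * M\<^sup>2 + 2 * (1 + S) * (p - S * M / (1 + S))\<^sup>2"
  proof -
    \<comment> \<open>Treating \<open>j\<close> as an indeterminate avoids fractions: the two sides
      differ by a multiple of \<open>S - j * (1 + S)\<close>, which is 0. The same device is used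
      below with \<open>S + 3\<close>.\<close>
    define j where "j = S / (1 + S)"
    have S: "S = j * (1 + S)" using assms by (simp add: j_def)
    have "2 * p\<^sup>2 + 2 * S * (p - M)\<^sup>2 - (2 * j * M\<^sup>2 + 2 * (1 + S) * (p - j * M)\<^sup>2) =
      (S - j * (1 + S)) * (2 * M\<^sup>2 - 4 * p * M + 2 * j * M\<^sup>2)"
      by (simp add: power2_eq_square algebra_simps)
    then show ?thesis using S by (simp add: j_def)
  qed
  have 3: "3 / 2 * r\<^sup>2 + S / 2 * (r - N)\<^sup>2 =
      3 / 2 * (S / (S + 3)) * N\<^sup>2 + (S + 3) / 2 * (r - S * N / (S + 3))\<^sup>2"
  proof -
    define j where "j = S / (S + 3)"
    have S: "S = j * (S + 3)" using assms by (simp add: j_def)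
    have "3 / 2 * r\<^sup>2 + S / 2 * (r - N)\<^sup>2 - (3 / 2 * j * N\<^sup>2 + (S + 3) / 2 * (r - j * N)\<^sup>2) =
      (S - j * (S + 3)) * (N\<^sup>2 / 2 - r * N + j * N\<^sup>2 / 2)"
      by (simp add: power2_eq_square field_simps)
    then show ?thesis using S by (simp add: j_def)
  qed
  have "(t - (m + k) / 2)\<^sup>2 = M\<^sup>2"
    by (simp add: M_def power2_commute)
  then show ?thesis
    unfolding 1 2 3 unfolding p_def r_def M_def N_def by simp
qed

text \<open>The inner vertex values \<open>a\<close> and \<open>b\<close> enter the right-hand side
  only through two squares with positive weights. One identity thus yields both the lower bound and
  the minimiser.\<close>

lemma trace_form_Suc_aux:
  fixes f g n t a b
  defines "S \<equiv> top_row_conductance n"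
    and "m \<equiv> row_mean n f" and "k \<equiv> row_mean n (\<lambda>i. f (2 ^ n + i))"
  shows "5 / 3 * (triangle_form t a b + trace_form n a f + trace_form n b (\<lambda>i. f (2 ^ n + i))) =
    trace_form (Suc n) t f +
    5 / 3 * (2 * (1 + S) * ((a + b) / 2 - t - S * ((m + k) / 2 - t) / (1 + S))\<^sup>2 +
    (S + 3) / 2 * (a - b - S * (m - k) / (S + 3))\<^sup>2)"
proof -
  have "S > 0" by (simp add: S_def top_row_conductance_pos)
  note elim = eliminate_inner_vertices[OF this, of t a b m k]
  have S: "10 / 3 * S / (1 + S) = 5 / 3 * (2 * (S / (1 + S)))" by simp
  show ?thesis
    unfolding trace_form_def row_form.simps row_mean.simps top_row_conductance.simps
    unfolding S_def[symmetric] m_def[symmetric] k_def[symmetric] S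
    using arg_cong[OF elim, of "\<lambda>e. 5 / 3 * e"] by (simp only: distrib_left mult.assoc)
qed

lemma trace_form_Suc_le:
  "trace_form (Suc n) t f \<le>
   5 / 3 * (triangle_form t a b + trace_form n a f + trace_form n b (\<lambda>i. f (2 ^ n + i)))"
  unfolding trace_form_Suc_aux using top_row_conductance_pos[of n] by simp

lemma trace_form_Suc_attained:
  obtains a b where "trace_form (Suc n) t f =
   5 / 3 * (triangle_form t a b + trace_form n a f + trace_form n b (\<lambda>i. f (2 ^ n + i)))"
proof -
  define S m k where "S = top_row_conductance n" and "m = row_mean n f"
    and "k = row_mean n (\<lambda>i. f (2 ^ n + i))"
  \<comment> \<open>The mean \<open>p\<close> and the difference \<open>r\<close> of the optimal
    inner values, read off from the requirement that both squares vanish.\<close>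
  define p r where "p = t + S * ((m + k) / 2 - t) / (1 + S)" and "r = S * (m - k) / (S + 3)"
  have "(p + r / 2 + (p - r / 2)) / 2 = p" "p + r / 2 - (p - r / 2) = r"
    by simp_all
  then have "(p + r / 2 + (p - r / 2)) / 2 - t - S * ((m + k) / 2 - t) / (1 + S) = 0"
    "p + r / 2 - (p - r / 2) - S * (m - k) / (S + 3) = 0"
    unfolding p_def r_def by linarith+
  from this[unfolded S_def m_def k_def] show ?thesis
    by (intro that[of "p + r / 2" "p - r / 2"]) (simp only: trace_form_Suc_aux, simp)
qed

section \<open>The trace form is a network form\<close>

text \<open>The indexing map \<open>\<phi>\<close> is arbitrary so that the induction hypothesis
  also covers the shifted right half.\<close>

lemma weighted_sum_row_mean:
  assumes "finite A" "\<And>i. i \<le> 2 ^ n \<Longrightarrow> \<phi> i \<in> A"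
  shows "weighted_sum A (\<lambda>h. row_mean n (\<lambda>i. h (\<phi> i))) 1"
  using assms(2)
proof (induction n arbitrary: \<phi>)
  case 0
  have "weighted_sum A (\<lambda>h. 1 / 2 * (h (\<phi> 0) + h (\<phi> 1))) (1 / 2 * (1 + 1))"
    using assms(1) 0 by (intro weighted_sum_scale weighted_sum_add weighted_sum_eval) auto
  then show ?case by simp
next
  case (Suc n)
  have "weighted_sum A (\<lambda>h. 1 / 2 * (row_mean n (\<lambda>i. h (\<phi> i)) + row_mean n (\<lambda>i. h (\<phi> (2 ^ n + i)))))
      (1 / 2 * (1 + 1))"
    by (intro weighted_sum_scale weighted_sum_add Suc.IH) (auto intro!: Suc.prems)
  then show ?case by simp
qed

lemma network_form_row_form:
  assumes "finite A" "\<And>i. i \<le> 2 ^ n \<Longrightarrow> \<phi> i \<in> A"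
  shows "network_form A (\<lambda>h. row_form n (\<lambda>i. h (\<phi> i)))"
  using assms(2)
proof (induction n arbitrary: \<phi>)
  case 0
  have "network_form A (\<lambda>h. 3 / 2 * (h (\<phi> 0) - h (\<phi> 1))\<^sup>2)"
    using assms(1) 0 weighted_sum_diff[of A "\<lambda>h. h (\<phi> 0)" 1 "\<lambda>h. h (\<phi> 1)" 1]
    by (intro network_form_scale network_form_square) (auto intro: weighted_sum_eval)
  then show ?case by simp
next
  case (Suc n)
  have 1: "weighted_sum A (\<lambda>h. row_mean n (\<lambda>i. h (\<phi> i)) - row_mean n (\<lambda>i. h (\<phi> (2 ^ n + i)))) (1 - 1)"
    by (intro weighted_sum_diff weighted_sum_row_mean assms(1)) (auto intro!: Suc.prems)
  show ?case
    unfolding row_form.simps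
    by (intro network_form_scale network_form_add network_form_square Suc.IH 1[simplified])
      (auto intro!: Suc.prems)
qed

lemma network_form_trace_form:
  assumes "finite A" "\<And>i. i \<le> 2 ^ n \<Longrightarrow> \<phi> i \<in> A" "z \<in> A"
  shows "network_form A (\<lambda>h. trace_form n (h z) (\<lambda>i. h (\<phi> i)))"
proof -
  have 1: "weighted_sum A (\<lambda>h. h z - row_mean n (\<lambda>i. h (\<phi> i))) (1 - 1)"
    by (intro weighted_sum_diff weighted_sum_row_mean weighted_sum_eval assms)
  show ?thesis
    unfolding trace_form_def
    by (intro network_form_add network_form_scale network_form_square network_form_row_form assms
        1[simplified])
qed

section \<open>Evaluation of the trace form and the recursion for the first edge\<close>

lemma row_mean_zero [simp]: "row_mean n (\<lambda>i. 0) = 0"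
  by (induction n) auto

lemma row_form_zero [simp]: "row_form n (\<lambda>i. 0) = 0"
  by (induction n) auto

lemma row_mean_add: "row_mean n (\<lambda>i. f i + g i) = row_mean n f + row_mean n g"
  by (induction n arbitrary: f g) (simp_all add: add_divide_distrib)

lemma row_mean_cong: "(\<And>i. i \<le> 2 ^ n \<Longrightarrow> f i = g i) \<Longrightarrow> row_mean n f = row_mean n g"
proof (induction n arbitrary: f g)
  case (Suc n)
  have "row_mean n f = row_mean n g" "row_mean n (\<lambda>i. f (2 ^ n + i)) = row_mean n (\<lambda>i. g (2 ^ n + i))"
    by (rule Suc.IH, rule Suc.prems, simp)+
  then show ?case by simp
qed simp

lemma row_form_cong: "(\<And>i. i \<le> 2 ^ n \<Longrightarrow> f i = g i) \<Longrightarrow> row_form n f = row_form n g"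
proof (induction n arbitrary: f g)
  case (Suc n)
  have "row_form n f = row_form n g" "row_form n (\<lambda>i. f (2 ^ n + i)) = row_form n (\<lambda>i. g (2 ^ n + i))"
    by (rule Suc.IH, rule Suc.prems, simp)+
  moreover have "row_mean n f = row_mean n g"
    "row_mean n (\<lambda>i. f (2 ^ n + i)) = row_mean n (\<lambda>i. g (2 ^ n + i))"
    by (rule row_mean_cong, rule Suc.prems, simp)+
  ultimately show ?case by simp
qed simp

lemma trace_form_cong:
  assumes "t = s" "\<And>i. i \<le> 2 ^ n \<Longrightarrow> f i = g i"
  shows "trace_form n t f = trace_form n s g"
proof -
  have "row_mean n f = row_mean n g" by (rule row_mean_cong) (rule assms(2))
  moreover have "row_form n f = row_form n g" by (rule row_form_cong) (rule assms(2))
  ultimately show ?thesis by (simp only: trace_form_def assms(1))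
qed

abbreviation unit0 :: "nat \<Rightarrow> real" where "unit0 \<equiv> \<lambda>i. if i = 0 then 1 else 0"
abbreviation unit1 :: "nat \<Rightarrow> real" where "unit1 \<equiv> \<lambda>i. if i = 1 then 1 else 0"

lemma row_mean_unit0: "row_mean n unit0 = 1 / 2 ^ Suc n"
  by (induction n) auto

lemma not_one_eq_power_add: "n \<ge> 1 \<Longrightarrow> (2::nat) ^ n + i = 1 \<longleftrightarrow> False"
  using power_increasing[of 1 n "2::nat"] by auto

text \<open>Level 0 is excluded because there index 1 is an end point of the row and carries only
  half the weight of an inner point.\<close>

lemma row_mean_unit1: "n \<ge> 1 \<Longrightarrow> row_mean n unit1 = 1 / 2 ^ n"
proof (induction n rule: nat_induct_at_least)
  case base
  show ?case by (simp add: One_nat_def)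
next
  case (Suc n)
  then show ?case by (simp add: not_one_eq_power_add)
qed

text \<open>The polarisation formula of \<open>network_form_coefficient\<close> for the first two
  row points, at both of which the top has value 0.\<close>

definition first_edge :: "nat \<Rightarrow> real" where
  "first_edge n = (trace_form n 0 unit0 + trace_form n 0 unit1 -
     trace_form n 0 (\<lambda>i. unit0 i + unit1 i)) / 2"

lemma first_edge_1: "first_edge 1 = 20 / 9"
  by (simp add: first_edge_def trace_form_def One_nat_def power2_eq_square)

text \<open>Both unit vectors live on the left half of the row, so the right half contributes
  nothing. Passing to the next level scales the row part by 5/3 and changes only the terms in the
  row means.\<close>

lemma first_edge_Suc:
  fixes n
  defines "S \<equiv> top_row_conductance n"
  assumes n: "n \<ge> 1"
  shows "first_edge (Suc n) = 5 / 3 * first_edge n +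
    5 / 3 * (S\<^sup>2 * (S + 2) / ((S + 1) * (S + 3))) / (2 * 4 ^ n)"
proof -
  have S: "S > 0" by (simp add: S_def top_row_conductance_pos)
  define m where "m = (1::real) / 2 ^ n"
  have m: "row_mean n unit0 = m / 2" "row_mean n unit1 = m"
    "row_mean n (\<lambda>i. unit0 i + unit1 i) = 3 / 2 * m"
    using n by (simp_all add: row_mean_add row_mean_unit0 row_mean_unit1 m_def)
  have m2: "1 / (2 * 4 ^ n) = m\<^sup>2 / 2"
    by (simp add: m_def power2_eq_square power_mult_distrib[symmetric])
  \<comment> \<open>The polarised row part, common to both levels; it cancels in the difference. The
    means \<open>m / 2\<close>, \<open>m\<close> and \<open>3 / 2 * m\<close> polarise to
    \<open>- m\<^sup>2 / 2\<close>.\<close>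
  define z where "z = (row_form n unit0 + row_form n unit1 - row_form n (\<lambda>i. unit0 i + unit1 i)) / 2"
  have l: "first_edge n = z - S * m\<^sup>2 / 2"
    unfolding first_edge_def trace_form_def m S_def[symmetric] z_def
    by (simp add: power2_eq_square field_simps)
  \<comment> \<open>Since \<open>n \<ge> 1\<close>, the indices 0 and 1 do not occur in the right
    half.\<close>
  have shift: "(\<lambda>i. if (2::nat) ^ n + i = 0 then 1 else 0::real) = (\<lambda>i. 0)"
    "(\<lambda>i. if (2::nat) ^ n + i = 1 then 1 else 0::real) = (\<lambda>i. 0)"
    "(\<lambda>i. (if (2::nat) ^ n + i = 0 then 1 else 0) + (if 2 ^ n + i = 1 then 1 else 0::real)) = (\<lambda>i. 0)"
    by (simp_all add: not_one_eq_power_add[OF n])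
  define C D where "C = 3 / 2 * (S / (S + 3))" and "D = 10 / 3 * S / (1 + S)"
  have l': "first_edge (Suc n) =
      5 / 3 * (z - C * m\<^sup>2 / 2) - D * m\<^sup>2 / 8"
    unfolding first_edge_def trace_form_def row_form.simps row_mean.simps top_row_conductance.simps
      shift m S_def[symmetric] z_def row_mean_zero row_form_zero C_def[symmetric] D_def[symmetric]
    by (simp add: power2_eq_square field_simps)
  have key: "S - 3 / 2 * (S / (S + 3)) - S / (2 * (1 + S)) = S\<^sup>2 * (S + 2) / ((S + 1) * (S + 3))"
    using S by (simp add: divide_simps power2_eq_square) (simp add: algebra_simps)
  have "first_edge (Suc n) - 5 / 3 * first_edge n =
      5 / 3 * (S - 3 / 2 * (S / (S + 3)) - S / (2 * (1 + S))) * (m\<^sup>2 / 2)"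
  proof -
    have "D * m\<^sup>2 / 8 = 5 / 3 * (S / (2 * (1 + S))) * (m\<^sup>2 / 2)"
      using S by (simp add: D_def field_simps)
    then show ?thesis unfolding l l' C_def
      by (simp only: left_diff_distrib right_diff_distrib)
  qed
  also have "\<dots> = 5 / 3 * (S\<^sup>2 * (S + 2) / ((S + 1) * (S + 3))) / (2 * 4 ^ n)"
    unfolding key m2[symmetric] by simp
  finally show ?thesis by simp
qed

lemma first_edge_closed:
  assumes "n \<ge> 1"
  shows "first_edge (n + 1) = 5 / 3 * first_edge n +
       98 * 25 ^ (n + 1) * (10 * 3 ^ (n + 1) + 39 * 10 ^ (n + 1)) /
       ((3 ^ (n + 1) + 6 * 10 ^ (n + 1)) * (5 * 3 ^ (n + 1) + 16 * 10 ^ (n + 1)) *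
        (5 * 3 ^ (n + 1) + 9 * 10 ^ (n + 1)))"
proof -
  define x y w T where "x = (3::real) ^ n" and "y = (10::real) ^ n" and "w = (25::real) ^ n"
    and "T = x + 6 * y"
  define S where "S = top_row_conductance n"
  have pos: "x > 0" "y > 0" "T > 0" "x + 20 * y > 0" "3 * x + 32 * y > 0"
    by (simp_all add: x_def y_def T_def add_pos_pos)
  \<comment> \<open>The source of the powers of 25: the numerator \<open>y\<^sup>2\<close> comes
    from the squared conductance and \<open>4 ^ n\<close> from the squared mean.\<close>
  have "(10::real) ^ n * 10 ^ n = 4 ^ n * 25 ^ n"
    by (simp add: power_mult_distrib[symmetric])
  then have w: "y\<^sup>2 / 4 ^ n = w"
    by (simp add: w_def y_def power2_eq_square)
  have S: "S = 14 * y / T"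
    by (simp add: S_def top_row_conductance_closed x_def y_def T_def)
  have S1: "S + 1 = (x + 20 * y) / T" and S2: "S + 2 = (2 * x + 26 * y) / T"
    and S3: "S + 3 = (3 * x + 32 * y) / T"
    using pos unfolding S by (simp_all add: divide_simps) (simp_all add: T_def)
  define A B C where "A = x + 20 * y" and "B = 3 * x + 32 * y" and "C = 2 * x + 26 * y"
  have ratio: "S\<^sup>2 * (S + 2) / ((S + 1) * (S + 3)) = (14 * y)\<^sup>2 * C / (T * A * B)"
  proof -
    have "(a / T)\<^sup>2 * (b / T) / ((c / T) * (d / T)) = a\<^sup>2 * b / (T * c * d)" for a b c d
      using \<open>T > 0\<close> by (simp add: power2_eq_square)
    then show ?thesis
      unfolding S1 S2 S3 A_def B_def C_def unfolding S by this
  qed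
  have "5 / 3 * (S\<^sup>2 * (S + 2) / ((S + 1) * (S + 3))) / (2 * 4 ^ n) =
      490 / 3 * (y\<^sup>2 / 4 ^ n) * (C / (T * A * B))"
    unfolding ratio by (simp add: power_mult_distrib mult_ac)
  \<comment> \<open>The factors 3, 5 and 15 turn \<open>A\<close>, \<open>B\<close>,
    \<open>T\<close> and \<open>C\<close> into expressions in \<open>3 * x\<close> and
    \<open>10 * y\<close>, that is, in the powers of exponent \<open>n + 1\<close>.\<close>
  also have "\<dots> = 98 * (25 * w) * (15 * C) / (3 * A * (5 * B) * (15 * T))"
    unfolding w by (simp add: mult_ac)
  finally have "5 / 3 * (S\<^sup>2 * (S + 2) / ((S + 1) * (S + 3))) / (2 * 4 ^ n) =
      98 * (25 * w) * (10 * (3 * x) + 39 * (10 * y)) /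
      ((3 * x + 6 * (10 * y)) * (5 * (3 * x) + 16 * (10 * y)) * (5 * (3 * x) + 9 * (10 * y)))"
    by (simp add: A_def B_def C_def T_def)
  then show ?thesis
    using first_edge_Suc[OF assms]
    by (simp only: S_def x_def y_def w_def Suc_eq_plus1[symmetric] power_Suc)
qed

section \<open>The gasket\<close>

definition centroid :: "(nat \<Rightarrow> real ^ 2) \<Rightarrow> real ^ 2" where
  "centroid q = (1/3) *\<^sub>R (q 0 + q 1 + q 2)"

text \<open>The barycentric coordinate of \<open>q i\<close>. In an equilateral triangle of side s
  the vectors from the centroid to the vertices have squared norm s^2/3 and mutual inner products
  -s^2/6, so this affine function is 1 at \<open>q i\<close> and 0 at the other vertices.\<close>

definition bary :: "(nat \<Rightarrow> real ^ 2) \<Rightarrow> nat \<Rightarrow> real ^ 2 \<Rightarrow> real" where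
  "bary q i x = 1/3 + 2 / (dist (q 0) (q 1))\<^sup>2 * ((x - centroid q) \<bullet> (q i - centroid q))"

text \<open>The second condition lets a point be recovered from its coordinates, as the
  identification of the common point of two cells requires.\<close>

definition full_triangle :: "(nat \<Rightarrow> real ^ 2) \<Rightarrow> (real ^ 2) set" where
  "full_triangle q = {x. (\<forall>i\<in>{0,1,2}. bary q i x \<ge> 0) \<and> (\<Sum>i\<in>{0,1,2}. bary q i x *\<^sub>R q i) = x}"

lemma continuous_on_F: "continuous_on A (F q i)"
  unfolding F_def by (intro continuous_intros)

lemma F_inject [simp]: "F q i x = F q i y \<longleftrightarrow> x = y"
  by (simp add: F_def)

lemma F_vertex [simp]: "F q i (q i) = q i"
  by (simp add: vec_eq_iff F_def)

lemma F_commute: "F q i (q j) = F q j (q i)"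
  by (simp add: F_def add.commute)

lemma dist_F: "dist (F q i x) (F q i y) = dist x y / 2"
proof -
  have "F q i x - F q i y = (1/2) *\<^sub>R (x - y)"
    by (simp add: vec_eq_iff F_def field_simps)
  then show ?thesis by (simp add: dist_norm)
qed

lemma V_subset_Suc: "V q m \<subseteq> V q (Suc m)"
proof (induction m)
  case 0
  show ?case
  proof
    fix x assume "x \<in> V q 0"
    then obtain i where "i \<in> {0,1,2}" "x = q i" by auto
    then have "x = F q i (q i)" "q i \<in> V q 0" by auto
    then show "x \<in> V q (Suc 0)"
      using \<open>i \<in> {0,1,2}\<close> unfolding V.simps(2) by blast
  qed
next
  case (Suc m)
  show ?case
    by (subst (1 2) V.simps(2)) (intro UN_mono image_mono Suc.IH order_refl)
qed

section \<open>Existence and uniqueness of the invariant compact set\<close>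

definition attractor :: "(nat \<Rightarrow> real ^ 2) \<Rightarrow> (real ^ 2) set" where
  "attractor q = closure (\<Union>m. V q m)"

text \<open>A point \<open>z\<close> of \<open>K\<close> at maximal distance from \<open>L\<close>
  is the image of some point of \<open>K\<close> under one of the contractions, which halve
  distances and preserve \<open>L\<close>. So the maximal distance is at most half of itself, hence
  0. Used in both directions, this gives uniqueness.\<close>

lemma invariant_compact_subset:
  assumes K: "compact K" "K = (\<Union>i\<in>{0,1,2}. F q i ` K)"
    and L: "compact L" "L \<noteq> {}" "L = (\<Union>i\<in>{0,1,2}. F q i ` L)"
  shows "K \<subseteq> L"
proof (cases "K = {}")
  case False
  have "continuous_on K (\<lambda>x. infdist x L)"
    by (intro continuous_intros)
  then obtain z where z: "z \<in> K" "\<And>x. x \<in> K \<Longrightarrow> infdist x L \<le> infdist z L"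
    using continuous_attains_sup[OF K(1) False] by blast
  obtain i y where i: "i \<in> {0,1,2}" "y \<in> K" "z = F q i y"
    using z(1) K(2) by blast
  obtain p where p: "p \<in> L" "infdist y L = dist y p"
    using infdist_attains_inf[OF compact_imp_closed[OF L(1)] L(2)] by blast
  have "F q i p \<in> L"
    using p(1) i(1) L(3) by blast
  then have "infdist z L \<le> dist z (F q i p)"
    by (rule infdist_le)
  also have "\<dots> = infdist y L / 2"
    by (simp add: i(3) dist_F p(2))
  also have "\<dots> \<le> infdist z L / 2"
    using z(2)[OF i(2)] by simp
  finally have "infdist z L \<le> 0" by simp
  show ?thesis
  proof
    fix x assume "x \<in> K"
    then have "infdist x L = 0"
      using z(2)[of x] \<open>infdist z L \<le> 0\<close> infdist_nonneg[of x L] by linarith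
    then show "x \<in> L"
      using in_closed_iff_infdist_zero[OF compact_imp_closed[OF L(1)] L(2)] by blast
  qed
qed simp

locale gasket =
  fixes q :: "nat \<Rightarrow> real ^ 2"
  assumes equilateral: "equilateral q"
begin

lemma side_pos: "dist (q 0) (q 1) > 0"
  using equilateral unfolding equilateral_def zero_less_dist_iff by blast

lemma bary_vertex:
  assumes "i \<in> {0,1,2}" "j \<in> {0,1,2}"
  shows "bary q i (q j) = (if i = j then 1 else 0)"
proof -
  \<comment> \<open>With \<open>q 0\<close> as origin, the three equal side lengths determine all
    inner products of the edge vectors: \<open>a \<bullet> b\<close> is half the squared
    side.\<close>
  define a b s where "a = q 1 - q 0" and "b = q 2 - q 0" and "s = dist (q 0) (q 1)"
  have q: "q 1 = q 0 + a" "q 2 = q 0 + b"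
    by (simp_all add: a_def b_def)
  have "a \<bullet> a = s\<^sup>2" "b \<bullet> b = s\<^sup>2" "(a - b) \<bullet> (a - b) = s\<^sup>2"
    using equilateral
    by (simp_all add: equilateral_def s_def dist_norm power2_norm_eq_inner[symmetric] a_def b_def
        norm_minus_commute)
  then have ab: "a \<bullet> a = s\<^sup>2" "b \<bullet> b = s\<^sup>2" "a \<bullet> b = s\<^sup>2 / 2" "b \<bullet> a = s\<^sup>2 / 2"
    by (simp_all add: inner_diff inner_commute)
  have c: "centroid q = q 0 + (1/3) *\<^sub>R (a + b)"
    by (simp add: vec_eq_iff centroid_def q)
  have d: "q 0 - centroid q = - ((1/3) *\<^sub>R a + (1/3) *\<^sub>R b)"
    "q 1 - centroid q = (2/3) *\<^sub>R a - (1/3) *\<^sub>R b"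
    "q 2 - centroid q = (2/3) *\<^sub>R b - (1/3) *\<^sub>R a"
    unfolding c q by (simp_all add: vec_eq_iff field_simps)
  have s: "s > 0" using side_pos by (simp add: s_def)
  show ?thesis
    using assms s unfolding bary_def s_def[symmetric]
    by (auto simp: d)
      (simp_all add: inner_add_left inner_add_right inner_diff_left inner_diff_right ab field_simps)
qed

lemma bary_F:
  assumes "i \<in> {0,1,2}" "j \<in> {0,1,2}"
  shows "bary q i (F q j x) = (bary q i x + (if i = j then 1 else 0)) / 2"
proof -
  have 1: "F q j x - centroid q = (1/2) *\<^sub>R ((x - centroid q) + (q j - centroid q))"
    by (simp add: vec_eq_iff F_def field_simps)
  have 2: "1/3 + k * (1/2 * (a + b)) = ((1/3 + k * a) + (1/3 + k * b)) / 2" for k a b :: real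
    by (simp add: field_simps)
  show ?thesis
    unfolding bary_vertex[OF assms, symmetric] bary_def 1 inner_scaleR_left inner_add_left
    by (rule 2)
qed

lemma bary_sum: "(\<Sum>i\<in>{0,1,2}. bary q i x) = 1"
proof -
  have "(q 0 - centroid q) + (q 1 - centroid q) + (q 2 - centroid q) = 0"
    by (simp add: vec_eq_iff centroid_def field_simps)
  then have "(x - centroid q) \<bullet> (q 0 - centroid q) + (x - centroid q) \<bullet> (q 1 - centroid q) +
      (x - centroid q) \<bullet> (q 2 - centroid q) = 0"
    unfolding inner_add_right[symmetric] by simp
  then have "(\<Sum>i\<in>{0,1,2}. (x - centroid q) \<bullet> (q i - centroid q)) = 0"
    by simp
  then show ?thesis
    unfolding bary_def sum.distrib sum_distrib_left[symmetric] by simp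
qed

lemma continuous_on_bary: "continuous_on A (bary q i)"
  unfolding bary_def by (intro continuous_intros)

lemma vertex_in_full_triangle: "i \<in> {0,1,2} \<Longrightarrow> q i \<in> full_triangle q"
  by (auto simp: full_triangle_def bary_vertex)

lemma F_full_triangle:
  assumes "i \<in> {0,1,2}" "x \<in> full_triangle q"
  shows "F q i x \<in> full_triangle q"
proof -
  have x: "\<forall>j\<in>{0,1,2}. bary q j x \<ge> 0" "(\<Sum>j\<in>{0,1,2}. bary q j x *\<^sub>R q j) = x"
    using assms(2) by (auto simp: full_triangle_def)
  have "(\<Sum>j\<in>{0,1,2}. bary q j (F q i x) *\<^sub>R q j) =
    (1/2) *\<^sub>R ((\<Sum>j\<in>{0,1,2}. bary q j x *\<^sub>R q j) + (\<Sum>j\<in>{0,1,2}. (if j = i then 1 else 0) *\<^sub>R q j))"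
    unfolding scaleR_right.sum sum.distrib[symmetric]
    using assms(1) by (intro sum.cong refl) (simp add: bary_F scaleR_left_distrib[symmetric] add_divide_distrib)
  also have "\<dots> = F q i x"
    unfolding x(2) using assms(1) by (auto simp: F_def)
  finally show ?thesis
    using x(1) assms(1) by (auto simp: full_triangle_def bary_F)
qed

lemma closed_full_triangle: "closed (full_triangle q)"
proof -
  have "full_triangle q = (\<Inter>i\<in>{0,1,2}. {x. 0 \<le> bary q i x}) \<inter>
      {x. (\<Sum>i\<in>{0,1,2}. bary q i x *\<^sub>R q i) = x}"
    by (auto simp: full_triangle_def)
  also have "closed \<dots>"
    by (intro closed_Int closed_INT ballI closed_Collect_le closed_Collect_eq continuous_intros
        continuous_on_bary)
  finally show ?thesis .
qed

lemma bary_le_1: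
  assumes "x \<in> full_triangle q" "i \<in> {0,1,2}"
  shows "bary q i x \<le> 1"
proof -
  have "bary q 0 x \<ge> 0" "bary q 1 x \<ge> 0" "bary q 2 x \<ge> 0"
    using assms(1) by (simp_all add: full_triangle_def)
  moreover have "bary q 0 x + bary q 1 x + bary q 2 x = 1"
    using bary_sum[of x] by simp
  ultimately show ?thesis
    using assms(2) by (elim insertE emptyE) auto
qed

lemma bounded_full_triangle: "bounded (full_triangle q)"
proof -
  have "norm x \<le> (\<Sum>i\<in>{0,1,2}. norm (q i))" if "x \<in> full_triangle q" for x
  proof -
    have "norm x = norm (\<Sum>i\<in>{0,1,2}. bary q i x *\<^sub>R q i)"
      using that by (simp add: full_triangle_def)
    also have "\<dots> \<le> (\<Sum>i\<in>{0,1,2}. norm (q i))"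
    proof (rule sum_norm_le)
      fix i :: nat assume i: "i \<in> {0,1,2}"
      have "\<bar>bary q i x\<bar> \<le> 1"
        using that i bary_le_1[OF that i] unfolding full_triangle_def by auto
      then show "norm (bary q i x *\<^sub>R q i) \<le> norm (q i)"
        by (simp add: mult_left_le_one_le)
    qed
    finally show ?thesis .
  qed
  then show ?thesis unfolding bounded_iff by blast
qed

lemma V_subset_full_triangle: "V q m \<subseteq> full_triangle q"
proof (induction m)
  case 0
  show ?case using vertex_in_full_triangle by simp
next
  case (Suc m)
  then show ?case unfolding V.simps(2) using F_full_triangle by blast
qed

lemma attractor_subset_full_triangle: "attractor q \<subseteq> full_triangle q"
  unfolding attractor_def
  by (intro closure_minimal closed_full_triangle UN_least V_subset_full_triangle)

lemma compact_attractor: "compact (attractor q)"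
proof -
  have "bounded (\<Union>m. V q m)"
    by (rule bounded_subset[OF bounded_full_triangle]) (intro UN_least V_subset_full_triangle)
  then show ?thesis
    unfolding attractor_def by (simp add: compact_closure)
qed

lemma attractor_invariant: "attractor q = (\<Union>i\<in>{0,1,2}. F q i ` attractor q)"
proof -
  let ?W = "\<Union>m. V q m"
  \<comment> \<open>Compactness of the closure makes its image closed, so closure commutes with each
    contraction.\<close>
  have cl: "closure (F q i ` ?W) = F q i ` closure ?W" for i
  proof
    have "compact (F q i ` closure ?W)"
      using compact_attractor unfolding attractor_def
      by (intro compact_continuous_image continuous_on_F)
    then show "closure (F q i ` ?W) \<subseteq> F q i ` closure ?W"
      by (intro closure_minimal image_mono closure_subset compact_imp_closed)
    show "F q i ` closure ?W \<subseteq> closure (F q i ` ?W)"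
      by (intro image_closure_subset closed_closure closure_subset continuous_on_F)
  qed
  \<comment> \<open>The sets \<open>V q m\<close> increase, so the union may start at level
    1.\<close>
  have "?W = (\<Union>m. V q (Suc m))"
    using V_subset_Suc by blast
  also have "\<dots> = (\<Union>i\<in>{0,1,2}. F q i ` ?W)"
    unfolding V.simps(2) by blast
  finally have "closure ?W = closure (\<Union>i\<in>{0,1,2}. F q i ` ?W)"
    by (rule arg_cong)
  also have "\<dots> = (\<Union>i\<in>{0,1,2}. F q i ` closure ?W)"
    by (simp only: UN_insert UN_empty closure_Un closure_empty cl)
  finally show ?thesis unfolding attractor_def .
qed

lemma attractor_nonempty: "attractor q \<noteq> {}"
proof -
  have "q 0 \<in> attractor q"
    unfolding attractor_def by (intro subsetD[OF closure_subset] UN_I[of 0]) auto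
  then show ?thesis by blast
qed

lemma SG_eq_attractor: "SG q = attractor q"
  unfolding SG_def
proof (rule the_equality)
  show "attractor q \<noteq> {} \<and> compact (attractor q) \<and> attractor q = (\<Union>i\<in>{0,1,2}. F q i ` attractor q)"
    using attractor_nonempty compact_attractor attractor_invariant by blast
  fix K assume K: "K \<noteq> {} \<and> compact K \<and> K = (\<Union>i\<in>{0,1,2}. F q i ` K)"
  show "K = attractor q"
  proof
    show "K \<subseteq> attractor q"
      using K by (intro invariant_compact_subset[OF _ _ compact_attractor attractor_nonempty
            attractor_invariant]) auto
    show "attractor q \<subseteq> K"
      using K by (intro invariant_compact_subset[OF compact_attractor attractor_invariant]) auto
  qed
qed

lemma SG_invariant: "SG q = (\<Union>i\<in>{0,1,2}. F q i ` SG q)"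
  unfolding SG_eq_attractor by (rule attractor_invariant)

lemma F_SG: "i \<in> {0,1,2} \<Longrightarrow> x \<in> SG q \<Longrightarrow> F q i x \<in> SG q"
  by (subst SG_invariant) (rule UN_I, assumption, rule imageI)

lemma compact_SG: "compact (SG q)"
  using compact_attractor by (simp only: SG_eq_attractor)

lemma V_subset_SG: "V q m \<subseteq> SG q"
  unfolding SG_eq_attractor attractor_def by (intro order_trans[OF _ closure_subset] UN_upper UNIV_I)

lemma vertex_in_SG: "i \<in> {0,1,2} \<Longrightarrow> q i \<in> SG q"
  using V_subset_SG[of 0] by auto

lemma SG_bary_nonneg: "x \<in> SG q \<Longrightarrow> i \<in> {0,1,2} \<Longrightarrow> bary q i x \<ge> 0"
  using subsetD[OF attractor_subset_full_triangle, of x]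
  by (simp only: SG_eq_attractor full_triangle_def mem_Collect_eq)

section \<open>Cells, edges and graph energies\<close>

text \<open>Comparing the coordinate at \<open>q i\<close> of both sides gives
  \<open>(bary q i x + 1) / 2 = bary q i y / 2\<close>, so \<open>bary q i y\<close> is at least 1.
  As the coordinates are nonnegative with sum 1, \<open>y\<close> is the vertex \<open>q i\<close>;
  the claim for \<open>x\<close> follows by symmetry.\<close>

lemma cells_meet_at_midpoint:
  assumes "i \<in> {0,1,2}" "j \<in> {0,1,2}" "i \<noteq> j" "x \<in> SG q" "y \<in> SG q" "F q i x = F q j y"
  shows "x = q j" and "y = q i"
proof -
  have aux: "y = q i"
    if "i \<in> {0,1,2}" "j \<in> {0,1,2}" "i \<noteq> j" "x \<in> SG q" "y \<in> SG q" "F q i x = F q j y" for i j x y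
  proof -
    have "(bary q i x + 1) / 2 = bary q i y / 2"
      using arg_cong[OF that(6), of "bary q i"] bary_F[OF that(1,1), of x] bary_F[OF that(1,2), of y]
        that(3) by simp
    then have 1: "bary q i y \<ge> 1"
      using SG_bary_nonneg[OF that(4,1)] by simp
    have "bary q 0 y \<ge> 0" "bary q 1 y \<ge> 0" "bary q 2 y \<ge> 0"
      using SG_bary_nonneg[OF that(5)] by auto
    moreover have "bary q 0 y + bary q 1 y + bary q 2 y = 1"
      using bary_sum[of y] by simp
    ultimately have k: "bary q k y = (if k = i then 1 else 0)" if "k \<in> {0,1,2}" for k
      using that \<open>i \<in> {0,1,2}\<close> 1 by (elim insertE emptyE) auto
    have "y \<in> full_triangle q"
      using that(5) attractor_subset_full_triangle unfolding SG_eq_attractor by blast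
    then have "y = (\<Sum>k\<in>{0,1,2}. bary q k y *\<^sub>R q k)"
      by (simp only: full_triangle_def mem_Collect_eq)
    also have "\<dots> = (\<Sum>k\<in>{0,1,2}. (if k = i then 1 else 0) *\<^sub>R q k)"
      using k by (intro sum.cong) auto
    also have "\<dots> = q i"
      using \<open>i \<in> {0,1,2}\<close> by auto
    finally show ?thesis .
  qed
  show "x = q j" "y = q i"
    using aux[OF assms] aux[of j i y x] assms by auto
qed

lemma F_word_vertices_subset_V: "set w \<subseteq> {0,1,2} \<Longrightarrow> F_word q w ` V q 0 \<subseteq> V q (length w)"
proof (induction w)
  case (Cons i w)
  then have "F_word q w ` V q 0 \<subseteq> V q (length w)" "i \<in> {0,1,2}" by auto
  then show ?case
    unfolding F_word.simps image_comp[symmetric] list.size(4) One_nat_def add_Suc_right add_0_right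
      V.simps(2) by blast
qed simp

lemma nbr_in_V:
  assumes "nbr q m x y"
  shows "x \<in> V q m" "y \<in> V q m"
proof -
  obtain w where w: "length w = m" "set w \<subseteq> {0,1,2}" "x \<in> F_word q w ` V q 0" "y \<in> F_word q w ` V q 0"
    using assms unfolding nbr_def by (elim conjE exE)
  note V = subsetD[OF F_word_vertices_subset_V[OF w(2), unfolded w(1)]]
  show "x \<in> V q m" "y \<in> V q m"
    by (rule V[OF w(3)], rule V[OF w(4)])
qed

lemma finite_V: "finite (V q m)"
  by (induction m) auto

lemma finite_nbr: "finite {(x, y). nbr q m x y}"
  by (rule finite_subset[of _ "V q m \<times> V q m"]) (auto simp: finite_V dest: nbr_in_V)

lemma nbr_Suc:
  "{(x, y). nbr q (Suc m) x y} = (\<Union>i\<in>{0,1,2}. map_prod (F q i) (F q i) ` {(x, y). nbr q m x y})"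
proof (intro equalityI subsetI)
  fix p assume "p \<in> {(x, y). nbr q (Suc m) x y}"
  then obtain x y w where p: "p = (x, y)" "x \<noteq> y" "length w = Suc m" "set w \<subseteq> {0,1,2}"
    "x \<in> F_word q w ` V q 0" "y \<in> F_word q w ` V q 0"
    unfolding nbr_def by auto
  then obtain i v where v: "w = i # v" by (cases w) auto
  obtain x' y' where x': "x' \<in> F_word q v ` V q 0" "x = F q i x'"
    "y' \<in> F_word q v ` V q 0" "y = F q i y'"
    using p(5,6) unfolding v F_word.simps image_comp[symmetric] by blast
  have "nbr q m x' y'"
    unfolding nbr_def using p(2-4) x' v by auto
  moreover have "i \<in> {0,1,2}" using p(4) v by auto
  ultimately show "p \<in> (\<Union>i\<in>{0,1,2}. map_prod (F q i) (F q i) ` {(x, y). nbr q m x y})"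
    unfolding p(1) x'(2,4) by force
next
  fix p assume "p \<in> (\<Union>i\<in>{0,1,2}. map_prod (F q i) (F q i) ` {(x, y). nbr q m x y})"
  then obtain i x y where p: "i \<in> {0,1,2}" "nbr q m x y" "p = (F q i x, F q i y)" by auto
  then obtain w where w: "length w = m" "set w \<subseteq> {0,1,2}" "x \<in> F_word q w ` V q 0"
    "y \<in> F_word q w ` V q 0" and "x \<noteq> y"
    unfolding nbr_def by auto
  have "nbr q (Suc m) (F q i x) (F q i y)"
    unfolding nbr_def
    using w p(1) \<open>x \<noteq> y\<close> by (intro conjI exI[of _ "i # w"]) (auto simp del: V.simps)
  then show "p \<in> {(x, y). nbr q (Suc m) x y}" using p by simp
qed

lemma graph_energy_0: "graph_energy q 0 u = triangle_form (u (q 0)) (u (q 1)) (u (q 2))"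
proof -
  have d: "q 0 \<noteq> q 1" "q 0 \<noteq> q 2" "q 1 \<noteq> q 2"
    using bary_vertex[of 0 0] bary_vertex[of 0 1] bary_vertex[of 0 2] bary_vertex[of 1 1]
      bary_vertex[of 1 2] by auto
  have "{(x, y). nbr q 0 x y} =
      {(q 0, q 1), (q 1, q 0), (q 0, q 2), (q 2, q 0), (q 1, q 2), (q 2, q 1)}"
    using d by (auto simp: nbr_def)
  then show ?thesis
    using d by (simp add: graph_energy_def triangle_form_def power2_commute)
qed

text \<open>No edge belongs to two cells: both of its end points would have to be the single common
  point of these cells. The edge sum therefore splits over the three cells.\<close>

lemma graph_energy_Suc:
  "graph_energy q (Suc m) u = 5 / 3 * (\<Sum>i\<in>{0,1,2}. graph_energy q m (\<lambda>x. u (F q i x)))"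
proof -
  let ?E = "\<lambda>i. map_prod (F q i) (F q i) ` {(x, y). nbr q m x y}"
  have disj: "?E i \<inter> ?E j = {}" if "i \<in> {0,1,2}" "j \<in> {0,1,2}" "i \<noteq> j" for i j
  proof -
    have False if "nbr q m x y" "nbr q m x' y'" "F q i x = F q j x'" "F q i y = F q j y'"
      for x y x' y'
    proof -
      have "{x, y, x', y'} \<subseteq> SG q" "x \<noteq> y"
        using nbr_in_V that(1,2) V_subset_SG by (blast, simp add: nbr_def)
      then show False
        using cells_meet_at_midpoint(1)[OF \<open>i \<in> {0,1,2}\<close> \<open>j \<in> {0,1,2}\<close> \<open>i \<noteq> j\<close>, of x x']
          cells_meet_at_midpoint(1)[OF \<open>i \<in> {0,1,2}\<close> \<open>j \<in> {0,1,2}\<close> \<open>i \<noteq> j\<close>, of y y'] that(3,4)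
        by auto
    qed
    then show ?thesis by auto
  qed
  have cell: "(\<Sum>(x, y)\<in>?E i. (u x - u y)\<^sup>2) =
      (\<Sum>(x, y)\<in>{(x, y). nbr q m x y}. (u (F q i x) - u (F q i y))\<^sup>2)" for i
    by (subst sum.reindex) (auto simp: inj_on_def case_prod_unfold)
  have "(\<Sum>(x, y)\<in>{(x, y). nbr q (Suc m) x y}. (u x - u y)\<^sup>2) =
      (\<Sum>i\<in>{0,1,2}. \<Sum>(x, y)\<in>?E i. (u x - u y)\<^sup>2)"
    unfolding nbr_Suc using disj finite_nbr by (intro sum.UNION_disjoint) auto
  also have "\<dots> = (\<Sum>i\<in>{0,1,2}. \<Sum>(x, y)\<in>{(x, y). nbr q m x y}. (u (F q i x) - u (F q i y))\<^sup>2)"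
    unfolding cell ..
  finally show ?thesis
    unfolding graph_energy_def
    by (simp only: power_Suc sum_distrib_left[symmetric] sum_divide_distrib[symmetric] mult.assoc)
qed

lemma graph_energy_cong:
  assumes "\<And>x. x \<in> SG q \<Longrightarrow> u x = v x"
  shows "graph_energy q m u = graph_energy q m v"
proof -
  have "u x = v x \<and> u y = v y" if "nbr q m x y" for x y
    using nbr_in_V[OF that] V_subset_SG assms by blast
  then show ?thesis
    unfolding graph_energy_def
    by (intro arg_cong2[of _ _ _ _ "(*)"] arg_cong2[of _ _ _ _ "(/)"] refl sum.cong) auto
qed

end

section \<open>Functions on the gasket with prescribed energy\<close>

text \<open>The cells \<open>i\<close> and \<open>j\<close> meet at the midpoint of \<open>q i\<close> and \<open>q j\<close>.\<close>

definition compatible :: "(nat \<Rightarrow> real ^ 2) \<Rightarrow> (nat \<Rightarrow> real ^ 2 \<Rightarrow> real) \<Rightarrow> bool" where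
  "compatible q u \<longleftrightarrow> (\<forall>i\<in>{0,1,2}. \<forall>j\<in>{0,1,2}. u i (q j) = u j (q i))"

text \<open>The value at \<open>z\<close> is read off from some cell containing it; for compatible
  functions the choice is immaterial. Off the gasket the value is unspecified.\<close>

definition glue :: "(nat \<Rightarrow> real ^ 2) \<Rightarrow> (nat \<Rightarrow> real ^ 2 \<Rightarrow> real) \<Rightarrow> real ^ 2 \<Rightarrow> real" where
  "glue q u z = (SOME t. \<exists>i\<in>{0,1,2}. \<exists>y\<in>SG q. z = F q i y \<and> t = u i y)"

text \<open>The harmonic value at \<open>F q i (q j)\<close> for vertex values \<open>a\<close>.
  Adding the sum of all three values produces the weights 2/5, 2/5, 1/5 without naming the third
  vertex.\<close>

definition refine :: "(nat \<Rightarrow> real) \<Rightarrow> nat \<Rightarrow> nat \<Rightarrow> real" where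
  "refine a i j = (if i = j then a i else (a i + a j + (a 0 + a 1 + a 2)) / 5)"

text \<open>On the gasket, the approximant of index \<open>m\<close> has the harmonic values on
  \<open>V q m\<close> and is affine on every cell of level \<open>m\<close>.\<close>

primrec harmonic_approx :: "(nat \<Rightarrow> real ^ 2) \<Rightarrow> nat \<Rightarrow> (nat \<Rightarrow> real) \<Rightarrow> real ^ 2 \<Rightarrow> real" where
  "harmonic_approx q 0 a = (\<lambda>x. \<Sum>i\<in>{0,1,2}. a i * bary q i x)"
| "harmonic_approx q (Suc m) a = glue q (\<lambda>i. harmonic_approx q m (refine a i))"

definition harmonic :: "(nat \<Rightarrow> real ^ 2) \<Rightarrow> (nat \<Rightarrow> real) \<Rightarrow> real ^ 2 \<Rightarrow> real" where
  "harmonic q a x = lim (\<lambda>m. harmonic_approx q m a x)"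

lemma refine_commute: "refine a i j = refine a j i"
  by (simp add: refine_def)

lemma refine_third_vertex:
  assumes "i \<in> {0,1,2}" "j \<in> {0,1,2}" "i \<noteq> j"
  obtains k where "k \<in> {0,1,2}" "5 * refine a i j = 2 * a i + 2 * a j + a k"
proof -
  have "\<exists>k\<in>{0,1,2}. a 0 + a 1 + a 2 = a i + a j + a k"
    using assms by (elim insertE emptyE) (simp_all add: add_ac)
  then obtain k where k: "k \<in> {0,1,2}" "a 0 + a 1 + a 2 = a i + a j + a k"
    by (elim bexE)
  show ?thesis
    by (rule that[OF k(1)]) (simp add: refine_def k(2) assms(3))
qed

text \<open>From the retained vertex to another one the difference is two fifths of one old
  difference plus one fifth of another; between the two new vertices it is one fifth of an old
  difference.\<close>

lemma refine_oscillation: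
  assumes "\<And>i j. i \<in> {0,1,2} \<Longrightarrow> j \<in> {0,1,2} \<Longrightarrow> \<bar>a i - a j\<bar> \<le> d"
    and "k \<in> {0,1,2}" "i \<in> {0,1,2}" "j \<in> {0,1,2}"
  shows "\<bar>refine a k i - refine a k j\<bar> \<le> 3/5 * d"
proof -
  have eq: "\<bar>refine a k k - refine a k j\<bar> \<le> 3/5 * d" if j: "j \<in> {0,1,2}" "k \<noteq> j" for j
  proof -
    obtain l where l: "l \<in> {0,1,2}" "5 * refine a k j = 2 * a k + 2 * a j + a l"
      using refine_third_vertex[OF assms(2) j] .
    then have "5 * (refine a k k - refine a k j) = 2 * (a k - a j) + (a k - a l)"
      by (simp add: refine_def[of a k k])
    moreover have "\<bar>p\<bar> \<le> 3/5 * d" if "5 * p = 2 * x + y" "\<bar>x\<bar> \<le> d" "\<bar>y\<bar> \<le> d" for p x y :: real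
      using that by linarith
    ultimately show ?thesis
      using assms(1)[OF assms(2) j(1)] assms(1)[OF assms(2) l(1)] by blast
  qed
  consider "i = j" | "k = i" "k \<noteq> j" | "k = j" "k \<noteq> i" | "k \<noteq> i" "k \<noteq> j"
    by blast
  then show ?thesis
  proof cases
    case 1
    then show ?thesis using assms(1)[OF assms(2,2)] by simp
  next
    case 2
    then show ?thesis using eq[OF assms(4)] by simp
  next
    case 3
    then show ?thesis using eq[OF assms(3)] by (simp add: abs_minus_commute)
  next
    case 4
    then have "refine a k i - refine a k j = (a i - a j) / 5"
      by (simp add: refine_def diff_divide_distrib[symmetric])
    moreover have "\<bar>x / 5\<bar> \<le> 3/5 * d" if "\<bar>x\<bar> \<le> d" for x
      using that by linarith
    ultimately show ?thesis using assms(1)[OF assms(3,4)] by (simp only:)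
  qed
qed

text \<open>Compares the harmonic value at a midpoint with the affine one; this is the error of a
  single refinement.\<close>

lemma refine_deviation:
  assumes "\<And>i j. i \<in> {0,1,2} \<Longrightarrow> j \<in> {0,1,2} \<Longrightarrow> \<bar>a i - a j\<bar> \<le> d"
    and "i \<in> {0,1,2}" "j \<in> {0,1,2}"
  shows "\<bar>refine a i j - (a i + a j) / 2\<bar> \<le> d"
proof (cases "i = j")
  case True
  then show ?thesis using assms(1)[OF assms(2,2)] by (simp add: refine_def)
next
  case False
  obtain k where k: "k \<in> {0,1,2}" "5 * refine a i j = 2 * a i + 2 * a j + a k"
    using refine_third_vertex[OF assms(2,3) False] .
  then have "10 * refine a i j = 4 * a i + 4 * a j + 2 * a k"
    by linarith
  then have "10 * (refine a i j - (a i + a j) / 2) = (a k - a i) + (a k - a j)"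
    by (simp add: field_simps)
  moreover have "\<bar>p\<bar> \<le> d" if "10 * p = x + y" "\<bar>x\<bar> \<le> d" "\<bar>y\<bar> \<le> d" for p x y :: real
    using that by linarith
  ultimately show ?thesis
    using assms(1)[OF k(1) assms(2)] assms(1)[OF k(1) assms(3)] by blast
qed

text \<open>The factor 5/3 exactly compensates the energy loss of harmonic refinement, so harmonic
  functions have the same graph energy at all levels.\<close>

lemma triangle_form_refine:
  "5 / 3 * (\<Sum>i\<in>{0,1,2}. triangle_form (refine a i 0) (refine a i 1) (refine a i 2)) =
   triangle_form (a 0) (a 1) (a 2)"
  by (simp add: triangle_form_def refine_def power2_eq_square field_simps)

context gasket
begin

section \<open>Gluing functions on the three cells\<close>

lemma glue_F:
  assumes "compatible q u"
    and "i \<in> {0,1,2}" "x \<in> SG q"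
  shows "glue q u (F q i x) = u i x"
  unfolding glue_def
proof (rule some_equality)
  show "\<exists>j\<in>{0,1,2}. \<exists>y\<in>SG q. F q i x = F q j y \<and> u i x = u j y"
    using assms(2,3) by blast
  fix t assume "\<exists>j\<in>{0,1,2}. \<exists>y\<in>SG q. F q i x = F q j y \<and> t = u j y"
  then obtain j y where j: "j \<in> {0,1,2}" "y \<in> SG q" "F q i x = F q j y" "t = u j y"
    by (elim bexE conjE)
  show "t = u i x"
  proof (cases "i = j")
    case True
    then show ?thesis using j(3,4) by simp
  next
    case False
    show ?thesis
      unfolding j(4) cells_meet_at_midpoint[OF assms(2) j(1) False assms(3) j(2,3)]
      using assms(1) j(1) assms(2) unfolding compatible_def by blast
  qed
qed

lemma glue_vertex:
  assumes "compatible q u" and "i \<in> {0,1,2}"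
  shows "glue q u (q i) = u i (q i)"
  using glue_F[OF assms(1) assms(2) vertex_in_SG[OF assms(2)]] by simp

lemma continuous_on_glue:
  assumes "compatible q u"
    and "\<And>i. i \<in> {0,1,2} \<Longrightarrow> continuous_on (SG q) (u i)"
  shows "continuous_on (SG q) (glue q u)"
proof (subst SG_invariant, rule continuous_on_closed_Union)
  fix i :: nat assume i: "i \<in> {0,1,2}"
  show "closed (F q i ` SG q)"
    by (intro compact_imp_closed compact_continuous_image continuous_on_F compact_SG)
  have inv: "2 *\<^sub>R F q i x - q i = x" for x
    by (simp add: F_def)
  \<comment> \<open>On each of the finitely many closed cells the glued function is
    \<open>u i\<close> composed with the inverse of \<open>F q i\<close>.\<close>
  have "continuous_on (F q i ` SG q) (u i \<circ> (\<lambda>z. 2 *\<^sub>R z - q i))"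
  proof (rule continuous_on_compose)
    have "(\<lambda>z. 2 *\<^sub>R z - q i) ` F q i ` SG q = SG q"
      by (simp only: image_image inv image_ident)
    then show "continuous_on ((\<lambda>z. 2 *\<^sub>R z - q i) ` F q i ` SG q) (u i)"
      using assms(2)[OF i] by simp
  qed (intro continuous_intros)
  also have "?this \<longleftrightarrow> continuous_on (F q i ` SG q) (glue q u)"
  proof (rule continuous_on_cong[OF refl])
    fix z assume "z \<in> F q i ` SG q"
    then obtain x where x: "x \<in> SG q" "z = F q i x" by (elim imageE)
    show "(u i \<circ> (\<lambda>z. 2 *\<^sub>R z - q i)) z = glue q u z"
      unfolding x(2) o_def inv using glue_F[OF assms(1) i x(1)] by (rule sym)
  qed
  finally show "continuous_on (F q i ` SG q) (glue q u)" .
qed simp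

section \<open>Harmonic functions\<close>

lemma harmonic_approx_vertex:
  "j \<in> {0,1,2} \<Longrightarrow> harmonic_approx q m a (q j) = a j"
proof (induction m arbitrary: a j)
  case 0
  have "(\<Sum>i\<in>{0,1,2}. a i * bary q i (q j)) = (\<Sum>i\<in>{0,1,2}. if i = j then a i else 0)"
    using bary_vertex[OF _ 0] by (intro sum.cong refl) simp
  then show ?case
    using 0 by auto
next
  case (Suc m)
  have "compatible q (\<lambda>i. harmonic_approx q m (refine a i))"
    unfolding compatible_def
  proof (intro ballI)
    fix i j :: nat assume "i \<in> {0,1,2}" "j \<in> {0,1,2}"
    then show "harmonic_approx q m (refine a i) (q j) = harmonic_approx q m (refine a j) (q i)"
      by (simp only: Suc.IH refine_commute[of a i])
  qed
  from glue_vertex[OF this Suc.prems] show ?case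
    unfolding harmonic_approx.simps Suc.IH[OF Suc.prems] by (simp add: refine_def)
qed

lemma harmonic_approx_compatible:
  "compatible q (\<lambda>i. harmonic_approx q m (refine a i))"
  unfolding compatible_def
proof (intro ballI)
  fix i j :: nat assume "i \<in> {0,1,2}" "j \<in> {0,1,2}"
  then show "harmonic_approx q m (refine a i) (q j) = harmonic_approx q m (refine a j) (q i)"
    by (simp only: harmonic_approx_vertex refine_commute[of a i])
qed

lemma harmonic_approx_F:
  assumes "i \<in> {0,1,2}" "x \<in> SG q"
  shows "harmonic_approx q (Suc m) a (F q i x) = harmonic_approx q m (refine a i) x"
  unfolding harmonic_approx.simps by (rule glue_F[OF harmonic_approx_compatible assms])

lemma continuous_on_harmonic_approx: "continuous_on (SG q) (harmonic_approx q m a)"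
proof (induction m arbitrary: a)
  case 0
  show ?case
    unfolding harmonic_approx.simps by (intro continuous_intros continuous_on_bary)
next
  case (Suc m)
  show ?case
    unfolding harmonic_approx.simps by (rule continuous_on_glue[OF harmonic_approx_compatible Suc.IH])
qed

text \<open>By self-similarity, the claim at level \<open>m\<close> is the claim at level 0 for data
  refined \<open>m\<close> times, whose oscillation has shrunk by \<open>(3/5) ^ m\<close>.\<close>

lemma harmonic_approx_step:
  assumes "\<And>i j. i \<in> {0,1,2} \<Longrightarrow> j \<in> {0,1,2} \<Longrightarrow> \<bar>a i - a j\<bar> \<le> d" and "x \<in> SG q"
  shows "\<bar>harmonic_approx q (Suc m) a x - harmonic_approx q m a x\<bar> \<le> d * (3/5) ^ m"
  using assms
proof (induction m arbitrary: a d x)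
  case 0
  obtain i y where i: "i \<in> {0,1,2}" "y \<in> SG q" "x = F q i y"
    using 0(2) by (subst (asm) SG_invariant) (elim UN_E imageE)
  have "harmonic_approx q (Suc 0) a x - harmonic_approx q 0 a x =
    (\<Sum>j\<in>{0,1,2}. refine a i j * bary q j y) - (\<Sum>j\<in>{0,1,2}. a j * bary q j (F q i y))"
    unfolding i(3) harmonic_approx_F[OF i(1,2)] harmonic_approx.simps(1) ..
  also have "(\<Sum>j\<in>{0,1,2}. a j * bary q j (F q i y)) =
    (\<Sum>j\<in>{0,1,2}. a j * bary q j y / 2) + (\<Sum>j\<in>{0,1,2}. if j = i then a i / 2 else 0)"
    unfolding sum.distrib[symmetric]
    using bary_F[OF _ i(1)] by (intro sum.cong refl) (simp add: field_simps)
  \<comment> \<open>Multiplying by the coordinate sum 1 spreads \<open>a i / 2\<close> over all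
    vertices, so the difference becomes a convex combination of the deviations at the vertices of
    the cell.\<close>
  also have "(\<Sum>j\<in>{0,1,2}. if j = i then a i / 2 else 0) = a i / 2 * (\<Sum>j\<in>{0,1,2}. bary q j y)"
    unfolding bary_sum using i(1) by auto
  also have "(\<Sum>j\<in>{0,1,2}. refine a i j * bary q j y) -
      ((\<Sum>j\<in>{0,1,2}. a j * bary q j y / 2) + a i / 2 * (\<Sum>j\<in>{0,1,2}. bary q j y)) =
      (\<Sum>j\<in>{0,1,2}. (refine a i j - (a i + a j) / 2) * bary q j y)"
    unfolding sum_distrib_left sum_subtractf[symmetric] sum.distrib[symmetric]
    by (intro sum.cong refl) (simp add: field_simps)
  finally have "\<bar>harmonic_approx q (Suc 0) a x - harmonic_approx q 0 a x\<bar> =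
    \<bar>\<Sum>j\<in>{0,1,2}. (refine a i j - (a i + a j) / 2) * bary q j y\<bar>" by simp
  also have "\<dots> \<le> (\<Sum>j\<in>{0,1,2}. d * bary q j y)"
  proof (rule order_trans[OF sum_abs sum_mono])
    fix j :: nat assume j: "j \<in> {0,1,2}"
    have "\<bar>refine a i j - (a i + a j) / 2\<bar> \<le> d"
      by (rule refine_deviation[OF 0(1) i(1) j])
    then show "\<bar>(refine a i j - (a i + a j) / 2) * bary q j y\<bar> \<le> d * bary q j y"
      using SG_bary_nonneg[OF i(2) j] by (simp add: abs_mult mult_right_mono)
  qed
  also have "\<dots> = d * (3/5) ^ 0"
    unfolding sum_distrib_left[symmetric] bary_sum by simp
  finally show ?case .
next
  case (Suc m)
  obtain i y where i: "i \<in> {0,1,2}" "y \<in> SG q" "x = F q i y"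
    using Suc.prems(2) by (subst (asm) SG_invariant) (elim UN_E imageE)
  have "\<bar>harmonic_approx q (Suc m) (refine a i) y - harmonic_approx q m (refine a i) y\<bar>
      \<le> (3/5 * d) * (3/5) ^ m"
    by (rule Suc.IH[OF refine_oscillation[OF Suc.prems(1) i(1)] i(2)])
  then show ?case
    unfolding i(3) harmonic_approx_F[OF i(1,2)] by (simp add: mult_ac)
qed

text \<open>The approximants are partial sums of a telescoping series dominated by a geometric
  series with ratio 3/5, so the Weierstrass test applies.\<close>

lemma uniform_limit_harmonic:
  "uniform_limit (SG q) (\<lambda>m. harmonic_approx q m a) (harmonic q a) sequentially"
proof -
  define d where "d = \<bar>a 0\<bar> + \<bar>a 1\<bar> + \<bar>a 2\<bar>"
  have d: "\<bar>a i - a j\<bar> \<le> d" if "i \<in> {0,1,2}" "j \<in> {0,1,2}" for i j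
    using that unfolding d_def by (elim insertE emptyE) auto
  define D where "D = (\<lambda>m x. harmonic_approx q (Suc m) a x - harmonic_approx q m a x)"
  have sum_D: "(\<Sum>k<m. D k x) = harmonic_approx q m a x - harmonic_approx q 0 a x" for m x
    unfolding D_def by (rule sum_lessThan_telescope)
  have "uniform_limit (SG q) (\<lambda>m x. \<Sum>k<m. D k x) (\<lambda>x. suminf (\<lambda>k. D k x)) sequentially"
  proof (rule Weierstrass_m_test)
    show "norm (D m x) \<le> d * (3/5) ^ m" if "x \<in> SG q" for m x
      unfolding D_def real_norm_def by (rule harmonic_approx_step[OF d that])
    show "summable (\<lambda>m. d * (3/5) ^ m)"
      by (intro summable_mult summable_geometric) simp
  qed
  from uniform_limit_add[OF this uniform_limit_const, of "harmonic_approx q 0 a"]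
  have lim: "uniform_limit (SG q) (\<lambda>m x. harmonic_approx q m a x)
      (\<lambda>x. suminf (\<lambda>k. D k x) + harmonic_approx q 0 a x) sequentially"
    unfolding sum_D diff_add_cancel .
  moreover have "harmonic q a x = suminf (\<lambda>k. D k x) + harmonic_approx q 0 a x" if "x \<in> SG q" for x
    unfolding harmonic_def by (rule limI[OF tendsto_uniform_limitI[OF lim that]])
  ultimately show ?thesis
    by (subst uniform_limit_cong'[OF refl]) auto
qed

lemma tendsto_harmonic: "x \<in> SG q \<Longrightarrow> (\<lambda>m. harmonic_approx q m a x) \<longlonglongrightarrow> harmonic q a x"
  by (rule tendsto_uniform_limitI[OF uniform_limit_harmonic])

lemma continuous_on_harmonic: "continuous_on (SG q) (harmonic q a)"
  by (rule uniform_limit_theorem[OF _ uniform_limit_harmonic])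
    (simp_all add: continuous_on_harmonic_approx)

lemma harmonic_vertex: "j \<in> {0,1,2} \<Longrightarrow> harmonic q a (q j) = a j"
  using tendsto_harmonic[OF vertex_in_SG, of j a]
  by (simp only: harmonic_approx_vertex LIMSEQ_const_iff)

lemma harmonic_F:
  assumes "i \<in> {0,1,2}" "x \<in> SG q"
  shows "harmonic q a (F q i x) = harmonic q (refine a i) x"
proof (rule LIMSEQ_unique)
  show "(\<lambda>m. harmonic_approx q m (refine a i) x) \<longlonglongrightarrow> harmonic q (refine a i) x"
    by (rule tendsto_harmonic[OF assms(2)])
  show "(\<lambda>m. harmonic_approx q m (refine a i) x) \<longlonglongrightarrow> harmonic q a (F q i x)"
    unfolding harmonic_approx_F[OF assms, symmetric]
    by (rule LIMSEQ_Suc[OF tendsto_harmonic[OF F_SG[OF assms]]])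
qed

lemma graph_energy_harmonic: "graph_energy q m (harmonic q a) = triangle_form (a 0) (a 1) (a 2)"
proof (induction m arbitrary: a)
  case 0
  show ?case by (simp add: graph_energy_0 harmonic_vertex)
next
  case (Suc m)
  have "graph_energy q m (\<lambda>x. harmonic q a (F q i x)) =
      triangle_form (refine a i 0) (refine a i 1) (refine a i 2)" if "i \<in> {0,1,2}" for i
    unfolding Suc.IH[symmetric] by (rule graph_energy_cong) (rule harmonic_F[OF that])
  then show ?case
    unfolding graph_energy_Suc triangle_form_refine[of a, symmetric]
    by (intro arg_cong2[of _ _ _ _ "(*)"] refl sum.cong)
qed

section \<open>Monotonicity of the graph energies\<close>

lemma graph_energy_le_Suc: "graph_energy q m u \<le> graph_energy q (Suc m) u"
proof (induction m arbitrary: u)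
  case 0
  have "triangle_form a b c \<le>
      5 / 3 * (triangle_form a z y + (triangle_form z b x + triangle_form y x c))" for a b c x y z
  proof -
    \<comment> \<open>Deviations of the midpoint values from the harmonic ones. Completing the
      square around the latter leaves the coarse energy plus nonnegative terms.\<close>
    define X Y Z where "X = x - (a + 2 * b + 2 * c) / 5" and "Y = y - (2 * a + b + 2 * c) / 5"
      and "Z = z - (2 * a + 2 * b + c) / 5"
    have x: "x = X + (a + 2 * b + 2 * c) / 5" "y = Y + (2 * a + b + 2 * c) / 5"
      "z = Z + (2 * a + 2 * b + c) / 5"
      by (simp_all add: X_def Y_def Z_def)
    have "5 / 3 * (triangle_form a z y + (triangle_form z b x + triangle_form y x c)) =
      triangle_form a b c + 5 / 3 * (2 * (X\<^sup>2 + Y\<^sup>2 + Z\<^sup>2) + triangle_form X Y Z)"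
      unfolding x triangle_form_def by (simp add: power2_eq_square field_simps)
    then show ?thesis by (simp add: triangle_form_def)
  qed
  \<comment> \<open>Every midpoint is a vertex of two cells; its two addresses are identified by
    \<open>F_commute\<close>.\<close>
  from this[of "u (q 0)" "u (q 1)" "u (q 2)" "u (F q 0 (q 1))" "u (F q 0 (q 2))" "u (F q 1 (q 2))"]
  show ?case
    unfolding graph_energy_Suc graph_energy_0
    by (simp add: F_commute[of q 1 0] F_commute[of q 2 0] F_commute[of q 2 1])
next
  case (Suc m)
  show ?case
    by (subst (1 2) graph_energy_Suc) (intro mult_left_mono sum_mono Suc.IH, simp)
qed

lemma energy_eq_SUP: "energy q u = (SUP m. ereal (graph_energy q m u))"
proof -
  have "incseq (\<lambda>m. ereal (graph_energy q m u))"
    by (rule incseq_SucI) (simp only: ereal_less_eq graph_energy_le_Suc)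
  then show ?thesis
    unfolding energy_def by (intro limI LIMSEQ_SUP)
qed

lemma graph_energy_le_energy: "ereal (graph_energy q m u) \<le> energy q u"
  unfolding energy_eq_SUP by (rule SUP_upper) simp

lemma energy_eqI:
  assumes "\<And>m. m \<ge> n \<Longrightarrow> graph_energy q m u = e"
  shows "energy q u = ereal e"
  unfolding energy_def
  by (intro limI tendsto_eventually) (use assms in \<open>auto simp: eventually_sequentially\<close>)

end

section \<open>Conductances of the bottom row and the top point\<close>

lemma bottom_pt_0 [simp]: "bottom_pt q n 0 = q 1"
  by (simp add: bottom_pt_def)

lemma bottom_pt_end [simp]: "bottom_pt q n (2 ^ n) = q 2"
  by (simp add: bottom_pt_def)

lemma F_bottom_pt:
  "F q 1 (bottom_pt q n i) = bottom_pt q (Suc n) i"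
  "F q 2 (bottom_pt q n i) = bottom_pt q (Suc n) (2 ^ n + i)"
  by (simp_all add: bottom_pt_def F_def vec_eq_iff field_simps)

text \<open>The middle point \<open>i = 2 ^ n\<close>, which lies in both halves, is assigned to the
  left one.\<close>

lemma bottom_pt_Suc_cases:
  assumes "i \<le> 2 ^ Suc n"
  obtains "i \<le> 2 ^ n" "bottom_pt q (Suc n) i = F q 1 (bottom_pt q n i)"
  | j where "j \<le> 2 ^ n" "i = 2 ^ n + j" "bottom_pt q (Suc n) i = F q 2 (bottom_pt q n j)"
proof (cases "i \<le> 2 ^ n")
  case True
  then show ?thesis using that(1) F_bottom_pt(1)[of q n i] by simp
next
  case False
  then have "i - 2 ^ n \<le> 2 ^ n" "i = 2 ^ n + (i - 2 ^ n)"
    using assms by simp_all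
  then show ?thesis using that(2)[of "i - 2 ^ n"] F_bottom_pt(2)[of q n "i - 2 ^ n"] by simp
qed

lemma finite_bottom_row_and_top: "finite (bottom_row_and_top q n)"
  by (simp add: bottom_row_and_top_def)

lemma bottom_pt_in_row: "i \<le> 2 ^ n \<Longrightarrow> bottom_pt q n i \<in> bottom_row_and_top q n"
  by (simp add: bottom_row_and_top_def)

lemma top_in_row: "q 0 \<in> bottom_row_and_top q n"
  by (simp add: bottom_row_and_top_def)

definition row_trace :: "(nat \<Rightarrow> real ^ 2) \<Rightarrow> nat \<Rightarrow> (real ^ 2 \<Rightarrow> real) \<Rightarrow> real" where
  "row_trace q n h = trace_form n (h (q 0)) (\<lambda>i. h (bottom_pt q n i))"

lemma row_trace_cong:
  assumes "\<forall>x\<in>bottom_row_and_top q n. u x = h x"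
  shows "row_trace q n u = row_trace q n h"
  unfolding row_trace_def
  using assms bottom_pt_in_row top_in_row by (intro trace_form_cong) blast+

lemma network_form_row_trace: "network_form (bottom_row_and_top q n) (row_trace q n)"
  unfolding row_trace_def[abs_def]
  by (rule network_form_trace_form[OF finite_bottom_row_and_top bottom_pt_in_row top_in_row])

context gasket
begin

lemma bottom_pt_in_SG: "i \<le> 2 ^ n \<Longrightarrow> bottom_pt q n i \<in> SG q"
proof (induction n arbitrary: i)
  case 0
  then have "i = 0 \<or> i = 1" by auto
  moreover have "bottom_pt q 0 1 = q 2" using bottom_pt_end[of q 0] by simp
  ultimately show ?case using vertex_in_SG[of 1] vertex_in_SG[of 2] by auto
next
  case (Suc n)
  from Suc.prems show ?case
  proof (cases rule: bottom_pt_Suc_cases[where q = q])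
    case 1
    then show ?thesis using F_SG[of 1] Suc.IH by simp
  next
    case (2 j)
    then show ?thesis using F_SG[of 2] Suc.IH by simp
  qed
qed

lemma bary_bottom_pt: "bary q 0 (bottom_pt q n i) = 0"
proof -
  define r where "r = real i / 2 ^ n"
  have 1: "bottom_pt q n i - centroid q = (1 - r) *\<^sub>R (q 1 - centroid q) + r *\<^sub>R (q 2 - centroid q)"
    by (simp add: bottom_pt_def r_def[symmetric] vec_eq_iff algebra_simps)
  have 2: "1/3 + k * ((1 - r) * a + r * b) = (1 - r) * (1/3 + k * a) + r * (1/3 + k * b)" for k a b
    by (simp add: field_simps)
  have "bary q 0 (bottom_pt q n i) = (1 - r) * bary q 0 (q 1) + r * bary q 0 (q 2)"
    unfolding bary_def 1 inner_add_left inner_scaleR_left by (rule 2)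
  then show ?thesis by (simp add: bary_vertex)
qed

lemma bottom_pt_neq_top: "bottom_pt q n i \<noteq> q 0"
  using bary_bottom_pt[of n i] bary_vertex[of 0 0] by auto

lemma bottom_pt_eq_iff: "bottom_pt q n i = bottom_pt q n j \<longleftrightarrow> i = j"
proof -
  have "q 2 - q 1 \<noteq> 0"
    using bary_vertex[of 1 2] bary_vertex[of 1 1] by auto
  then show ?thesis by (simp add: bottom_pt_def)
qed

section \<open>The trace form is the least energy\<close>

text \<open>The lower bound: the top cell has at least the energy of its vertex triangle, the two
  lower cells are covered by the induction hypothesis, and \<open>trace_form_Suc_le\<close>
  eliminates the inner vertices.\<close>

lemma row_trace_le_graph_energy: "row_trace q n u \<le> graph_energy q n u"
proof (induction n arbitrary: u)
  case 0
  have "bottom_pt q 0 1 = q 2" using bottom_pt_end[of q 0] by simp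
  then show ?case by (simp add: row_trace_def trace_form_0 graph_energy_0)
next
  case (Suc n)
  let ?u = "\<lambda>i x. u (F q i x)"
  have 0: "triangle_form (u (q 0)) (?u 1 (q 0)) (?u 2 (q 0)) \<le> graph_energy q n (?u 0)"
  proof -
    have "graph_energy q 0 (?u 0) \<le> graph_energy q n (?u 0)"
      by (rule lift_Suc_mono_le[where f = "\<lambda>m. graph_energy q m (?u 0)"]) (simp_all only: graph_energy_le_Suc le0)
    then show ?thesis
      by (simp add: graph_energy_0 F_commute[of q 0])
  qed
  have "row_trace q (Suc n) u \<le> 5 / 3 * (triangle_form (u (q 0)) (?u 1 (q 0)) (?u 2 (q 0)) +
      trace_form n (?u 1 (q 0)) (\<lambda>i. u (bottom_pt q (Suc n) i)) +
      trace_form n (?u 2 (q 0)) (\<lambda>i. u (bottom_pt q (Suc n) (2 ^ n + i))))"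
    unfolding row_trace_def by (rule trace_form_Suc_le)
  also have "\<dots> = 5 / 3 * (triangle_form (u (q 0)) (?u 1 (q 0)) (?u 2 (q 0)) +
      row_trace q n (?u 1) + row_trace q n (?u 2))"
    unfolding row_trace_def F_bottom_pt ..
  also have "\<dots> \<le> 5 / 3 * (graph_energy q n (?u 0) + graph_energy q n (?u 1) + graph_energy q n (?u 2))"
    by (intro mult_left_mono add_mono 0 Suc.IH) simp
  also have "\<dots> = graph_energy q (Suc n) u"
    unfolding graph_energy_Suc by simp
  finally show ?case .
qed

text \<open>A minimiser is built recursively: harmonic on the top cell with the optimal inner
  values, and minimisers of the previous level on the two lower cells. Its graph energy is constant
  from level \<open>n\<close> on, so it is also its energy.\<close>

lemma trace_form_realized:
  obtains u where "continuous_on (SG q) u" "u (q 0) = t" "\<And>i. i \<le> 2 ^ n \<Longrightarrow> u (bottom_pt q n i) = f i"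
    "\<And>m. m \<ge> n \<Longrightarrow> graph_energy q m u = trace_form n t f"
proof -
  have "\<exists>u. continuous_on (SG q) u \<and> u (q 0) = t \<and> (\<forall>i\<le>2 ^ n. u (bottom_pt q n i) = f i) \<and>
    (\<forall>m\<ge>n. graph_energy q m u = trace_form n t f)"
  proof (induction n arbitrary: t f)
    case 0
    define a where "a = (\<lambda>i::nat. if i = 0 then t else if i = 1 then f 0 else f 1)"
    have a: "a 0 = t" "a 1 = f 0" "a 2 = f 1"
      by (simp_all add: a_def)
    have v: "harmonic q a (q 0) = t" "harmonic q a (q 1) = f 0" "harmonic q a (q 2) = f 1"
      using harmonic_vertex[of 0 a] harmonic_vertex[of 1 a] harmonic_vertex[of 2 a] a by simp_all
    have "harmonic q a (bottom_pt q 0 i) = f i" if "i \<le> 2 ^ 0" for i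
    proof -
      have "i = 0 \<or> i = 1" using that by auto
      moreover have "bottom_pt q 0 1 = q 2" using bottom_pt_end[of q 0] by simp
      ultimately show ?thesis using v by auto
    qed
    then show ?case
      using continuous_on_harmonic[of a] v(1) graph_energy_harmonic[of _ a]
      by (intro exI[of _ "harmonic q a"]) (simp add: a trace_form_0)
  next
    case (Suc n)
    obtain a b where ab: "trace_form (Suc n) t f =
        5 / 3 * (triangle_form t a b + trace_form n a f + trace_form n b (\<lambda>i. f (2 ^ n + i)))"
      by (rule trace_form_Suc_attained)
    define k where "k = (\<lambda>i::nat. if i = 0 then t else if i = 1 then a else b)"
    define v0 where "v0 = harmonic q k"
    have k: "k 0 = t" "k 1 = a" "k 2 = b"
      by (simp_all add: k_def)
    have v0: "v0 (q 0) = t" "v0 (q 1) = a" "v0 (q 2) = b"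
      unfolding v0_def using harmonic_vertex[of 0 k] harmonic_vertex[of 1 k] harmonic_vertex[of 2 k] k
      by simp_all
    obtain v1 where v1: "continuous_on (SG q) v1" "v1 (q 0) = a"
      "\<And>i. i \<le> 2 ^ n \<Longrightarrow> v1 (bottom_pt q n i) = f i"
      "\<And>m. m \<ge> n \<Longrightarrow> graph_energy q m v1 = trace_form n a f"
      using Suc.IH[of a f] by blast
    obtain v2 where v2: "continuous_on (SG q) v2" "v2 (q 0) = b"
      "\<And>i. i \<le> 2 ^ n \<Longrightarrow> v2 (bottom_pt q n i) = f (2 ^ n + i)"
      "\<And>m. m \<ge> n \<Longrightarrow> graph_energy q m v2 = trace_form n b (\<lambda>i. f (2 ^ n + i))"
      using Suc.IH[of b "\<lambda>i. f (2 ^ n + i)"] by blast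
    define v where "v = (\<lambda>i::nat. if i = 0 then v0 else if i = 1 then v1 else v2)"
    have v: "v 0 = v0" "v 1 = v1" "v 2 = v2"
      by (simp_all add: v_def)
    \<comment> \<open>The cells must agree at three points: at the inner vertices with values
      \<open>a\<close> and \<open>b\<close>, and at the middle of the row with value
      \<open>f (2 ^ n)\<close>, the last index on the left and index 0 on the right.\<close>
    have comp: "compatible q v"
      using v0 v1(2) v2(2) v1(3)[of "2 ^ n"] v2(3)[of 0] by (simp add: compatible_def v)
    define u where "u = glue q v"
    have u: "u (F q i x) = v i x" if "i \<in> {0,1,2}" "x \<in> SG q" for i x
      unfolding u_def by (rule glue_F[OF comp that])
    have "continuous_on (SG q) u"
      unfolding u_def
      using continuous_on_harmonic[of k] v1(1) v2(1)
      by (intro continuous_on_glue[OF comp]) (auto simp: v v0_def)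
    moreover have "u (q 0) = t"
      using glue_vertex[OF comp, of 0] by (simp add: u_def v v0)
    moreover have "u (bottom_pt q (Suc n) i) = f i" if "i \<le> 2 ^ Suc n" for i
      using that
    proof (cases rule: bottom_pt_Suc_cases[where q = q])
      case 1
      then show ?thesis
        using u[of 1 "bottom_pt q n i"] bottom_pt_in_SG[OF 1(1)] by (simp add: v v1(3))
    next
      case (2 j)
      then show ?thesis
        using u[of 2 "bottom_pt q n j"] bottom_pt_in_SG[OF 2(1)] by (simp add: v v2(3))
    qed
    moreover have "graph_energy q m u = trace_form (Suc n) t f" if m: "m \<ge> Suc n" for m
    proof -
      obtain m' where m': "m = Suc m'" "m' \<ge> n"
        using m by (cases m) auto
      have "graph_energy q m' (\<lambda>x. u (F q i x)) = graph_energy q m' (v i)" if "i \<in> {0,1,2}" for i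
        by (rule graph_energy_cong) (rule u[OF that])
      then have "graph_energy q m u =
          5 / 3 * (graph_energy q m' v0 + graph_energy q m' v1 + graph_energy q m' v2)"
        unfolding m'(1) graph_energy_Suc by (simp add: v)
      then show ?thesis
        unfolding ab v1(4)[OF m'(2)] v2(4)[OF m'(2)] by (simp add: v0_def graph_energy_harmonic k)
    qed
    ultimately show ?case by blast
  qed
  then show ?thesis using that by blast
qed

lemma row_trace_le_energy: "ereal (row_trace q n u) \<le> energy q u"
  using order_trans[OF _ graph_energy_le_energy[of n u], of "ereal (row_trace q n u)"]
  by (simp add: row_trace_le_graph_energy)

lemma least_energy_extension_exists:
  obtains u where "least_energy_extension q (bottom_row_and_top q n) h u"
    "energy q u = ereal (row_trace q n h)"
proof -
  obtain u where u: "continuous_on (SG q) u" "u (q 0) = h (q 0)"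
    "\<And>i. i \<le> 2 ^ n \<Longrightarrow> u (bottom_pt q n i) = h (bottom_pt q n i)"
    "\<And>m. m \<ge> n \<Longrightarrow> graph_energy q m u = row_trace q n h"
    using trace_form_realized[of "h (q 0)" n "\<lambda>i. h (bottom_pt q n i)"] unfolding row_trace_def by blast
  have e: "energy q u = ereal (row_trace q n h)"
    by (rule energy_eqI[OF u(4)])
  have "energy q u \<le> energy q v" if "\<forall>x\<in>bottom_row_and_top q n. v x = h x" for v
    unfolding e row_trace_cong[OF that, symmetric] by (rule row_trace_le_energy)
  moreover have "u \<in> dom_energy q"
    using u(1) e by (simp add: dom_energy_def)
  moreover have "\<forall>x\<in>bottom_row_and_top q n. u x = h x"
    using u(2,3) by (auto simp: bottom_row_and_top_def)
  ultimately have "least_energy_extension q (bottom_row_and_top q n) h u"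
    by (simp add: least_energy_extension_def)
  then show ?thesis using e by (rule that)
qed

section \<open>From the trace form to conductances\<close>

text \<open>All least-energy extensions of \<open>h\<close> have the same energy and agree with
  \<open>h\<close> on the set, so the existential condition on \<open>u\<close> becomes an identity
  between quadratic forms in \<open>h\<close>.\<close>

lemma is_conductances_iff:
  "is_conductances q (bottom_row_and_top q n) c \<longleftrightarrow>
     (\<forall>x y. c x y = c y x) \<and>
     (\<forall>x y. x \<notin> bottom_row_and_top q n \<or> y \<notin> bottom_row_and_top q n \<or> x = y \<longrightarrow> c x y = 0) \<and>
     (\<forall>h. row_trace q n h =
       (\<Sum>(x, y)\<in>bottom_row_and_top q n \<times> bottom_row_and_top q n. c x y * (h x - h y)\<^sup>2) / 2)"
proof -
  let ?A = "bottom_row_and_top q n"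
  have "(\<exists>u. least_energy_extension q ?A h u \<and>
        energy q u = ereal ((\<Sum>(x, y) \<in> ?A \<times> ?A. c x y * (u x - u y)\<^sup>2) / 2)) \<longleftrightarrow>
     row_trace q n h = (\<Sum>(x, y)\<in>?A \<times> ?A. c x y * (h x - h y)\<^sup>2) / 2" (is "?L \<longleftrightarrow> ?R") for h
  proof -
    obtain w where w: "least_energy_extension q ?A h w" "energy q w = ereal (row_trace q n h)"
      by (rule least_energy_extension_exists)
    have e: "energy q u = ereal (row_trace q n h)" if "least_energy_extension q ?A h u" for u
      using that w unfolding least_energy_extension_def by (intro antisym) auto
    have s: "(\<Sum>(x, y) \<in> ?A \<times> ?A. c x y * (u x - u y)\<^sup>2) = (\<Sum>(x, y)\<in>?A \<times> ?A. c x y * (h x - h y)\<^sup>2)"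
      if "least_energy_extension q ?A h u" for u
      using that unfolding least_energy_extension_def by (intro sum.cong) auto
    show ?thesis
    proof
      assume ?L
      then obtain u where "least_energy_extension q ?A h u"
        "energy q u = ereal ((\<Sum>(x, y) \<in> ?A \<times> ?A. c x y * (u x - u y)\<^sup>2) / 2)"
        by (elim exE conjE)
      then show ?R using e s by simp
    next
      assume ?R
      then show ?L by (intro exI[of _ w] conjI w(1)) (simp only: s[OF w(1)] w(2))
    qed
  qed
  then show ?thesis
    unfolding is_conductances_def by simp
qed

text \<open>Existence comes from the network form of the trace; uniqueness holds because
  polarisation determines each coefficient, which justifies the definite description.\<close>

lemma conductance_eq:
  assumes "x \<in> bottom_row_and_top q n" "y \<in> bottom_row_and_top q n" "x \<noteq> y"
  shows "conductance q (bottom_row_and_top q n) x y = (row_trace q n (indicator {x}) +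
    row_trace q n (indicator {y}) - row_trace q n (indicator {x, y})) / 2"
proof -
  let ?A = "bottom_row_and_top q n"
  have coeff: "c x y = (row_trace q n (indicator {x}) + row_trace q n (indicator {y}) -
      row_trace q n (indicator {x, y})) / 2"
    if "is_conductances q ?A c" "x \<in> ?A" "y \<in> ?A" "x \<noteq> y" for c x y
    using that unfolding is_conductances_iff
    by (intro network_form_coefficient[OF finite_bottom_row_and_top]) auto
  obtain c where "\<And>x y. c x y = c y x" "\<And>x y. x \<notin> ?A \<or> y \<notin> ?A \<or> x = y \<Longrightarrow> c x y = 0"
    "\<And>h. row_trace q n h = (\<Sum>(x, y)\<in>?A \<times> ?A. c x y * (h x - h y)\<^sup>2) / 2"
    by (rule network_form_symmetric[OF network_form_row_trace]) blast
  then have c: "is_conductances q ?A c"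
    unfolding is_conductances_iff by blast
  have "conductance q ?A = c"
    unfolding conductance_def
  proof (rule the_equality)
    show "is_conductances q ?A c" by (rule c)
    fix d assume d: "is_conductances q ?A d"
    show "d = c"
    proof (intro ext)
      fix x y
      show "d x y = c x y"
      proof (cases "x \<in> ?A \<and> y \<in> ?A \<and> x \<noteq> y")
        case True
        then show ?thesis using coeff[OF c, of x y] coeff[OF d, of x y] by simp
      next
        case False
        then have "c x y = 0" "d x y = 0"
          using c d unfolding is_conductances_def by blast+
        then show ?thesis by simp
      qed
    qed
  qed
  then show ?thesis using coeff[OF c assms] by simp
qed

lemma l_eq_first_edge: "l q n = first_edge n"
proof -
  let ?x = "bottom_pt q n 0" and ?y = "bottom_pt q n 1"
  have "?x \<noteq> ?y" unfolding bottom_pt_eq_iff by simp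
  moreover have "?x \<in> bottom_row_and_top q n" "?y \<in> bottom_row_and_top q n"
    by (intro bottom_pt_in_row; simp)+
  ultimately have "l q n = (row_trace q n (indicator {?x}) + row_trace q n (indicator {?y}) -
      row_trace q n (indicator {?x, ?y})) / 2"
    unfolding l_def by (intro conductance_eq)
  \<comment> \<open>Distinct indices give distinct row points, so the indicators restrict to unit
    vectors on the row; they vanish at the top, which is not a row point.\<close>
  moreover have "(\<lambda>i. indicator {?x} (bottom_pt q n i)) = unit0" "(\<lambda>i. indicator {?y} (bottom_pt q n i)) = unit1"
    "(\<lambda>i. indicator {?x, ?y} (bottom_pt q n i)) = (\<lambda>i. unit0 i + unit1 i)"
    by (auto simp: indicator_def bottom_pt_eq_iff simp del: bottom_pt_0)
  moreover have "indicator {?x} (q 0) = (0::real)" "indicator {?y} (q 0) = (0::real)"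
    "indicator {?x, ?y} (q 0) = (0::real)"
    using bottom_pt_neq_top[of n 0] bottom_pt_neq_top[of n 1]
    by (auto simp: indicator_def simp del: bottom_pt_0)
  ultimately show ?thesis
    by (simp only: row_trace_def first_edge_def)
qed

end

theorem lemma2p19:
  fixes q :: "nat \<Rightarrow> real ^ 2"
  assumes "equilateral q"
  shows "l q 1 = 20 / 9 \<and>
    (\<forall>n\<ge>1. l q (n + 1) = 5 / 3 * l q n +
       98 * 25 ^ (n + 1) * (10 * 3 ^ (n + 1) + 39 * 10 ^ (n + 1)) /
       ((3 ^ (n + 1) + 6 * 10 ^ (n + 1)) * (5 * 3 ^ (n + 1) + 16 * 10 ^ (n + 1)) *
        (5 * 3 ^ (n + 1) + 9 * 10 ^ (n + 1))))"
proof -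
  interpret gasket q by standard (rule assms)
  show ?thesis
    unfolding l_eq_first_edge using first_edge_1 first_edge_closed by blast
qed

end
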